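(* Let $d\ge 1$ be an integer, let $\mathcal D_\rho>0$, $\mathcal D_{m_1},\dots,\mathcal D_{m_d}>0$ and $\zeta>0$ be real numbers, and let $M$ be a concave mobility of one of the following two forms: (I) $M(\rho)=(\rho-\alpha)^{\xi}(\beta-\rho)^{\xi}$ with $\alpha<\beta$, $\xi\in(0,1]$, for $\alpha\le\rho\le\beta$; (II) $M(\rho)=\rho^{\xi}$ with $\xi\in(0,1]$, for $\rho\ge 0$. Let $\varphi$ be the action function associated with $M$, and let $L$ be the scalar function associated with the data (both defined in the context). Then for an input $(\hat\rho,\hat{\boldsymbol m})\in\mathbb R\times\mathbb R^d$ the following hold. (A) The problem $$\min_{\rho,\boldsymbol m}\ \tfrac12\mathcal D_\rho(\rho-\hat\rho)^2+\tfrac12\sum_{j=1}^d\mathcal D_{m_j}(m_j-\hat m_j)^2+\tfrac{\zeta}{2}\varphi(\rho,\boldsymbol m)$$ admits a unique solution $(\rho^*,\boldsymbol m^* )$ within the bounds, such that $M(\rho^* )\ge 0$. (B) The distribution of the solution $\rho^*$ depending on the input $(\hat\rho,\hat{\boldsymbol m})$ is given by the following list. Each row gives, for a range of $\hat\rho$: the interval containing the root of $L$; the sign of $L''$ over that interval (where it is used); and either the initial value $\rho_0$ for Newton's method or directly the optimal value $\rho^*$. Here $$\rho_m=\frac{\alpha+\beta}{2},\qquad C_1=\frac{-1}{2\zeta\mathcal D_\rho}\sum_{j=1}^d(\mathcal D_{m_j}\hat m_j)^2,\qquad C_2=\frac{\beta-\alpha}{2\zeta\mathcal D_\rho}\sum_{j=1}^d(\mathcal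 D_{m_j}\hat m_j)^2,$$ and $\delta$ is a small positive parameter. 1. $M(\rho)=\rho^\xi$, $\xi\in(0,1)$, $\rho\ge0$: - $\hat\rho\le\delta$: root interval $(0,+\infty)$, $L''<0$, $\rho_0=\delta$; - $\hat\rho>\delta$: root interval $(\hat\rho,+\infty)$, $L''<0$, $\rho_0=\hat\rho$. 2. $M(\rho)=\rho$, $\rho\ge0$: - $\hat\rho\le C_1$: root interval $(-\infty,0]$, $\rho^*=0$; - $\hat\rho>C_1$: root interval $(0,+\infty)$, $L''<0$, $\rho_0=0$. 3. $M(\rho)=(\rho-\alpha)^\xi(\beta-\rho)^\xi$, $\xi\in(0,1)$, $\alpha\le\rho\le\beta$: - $\hat\rho<\rho_m$: root interval $(\alpha,\rho_m)$, $L''<0$, $\rho_0=\alpha+\delta$; - $\hat\rho=\rho_m$: root interval $\{\rho_m\}$, $\rho^*=\rho_m$; - $\hat\rho>\rho_m$: root interval $(\rho_m,\beta)$, $L''>0$, $\rho_0=\beta-\delta$. 4. $M(\rho)=(\rho-\alpha)(\beta-\rho)$, $\alpha\le\rho\le\beta$: - $\hat\rho\le\alpha-C_2$: root interval $(-\infty,\alpha]$, $\rho^*=\alpha$; - $\alpha-C_2<\hat\rho<\rho_m$: root interval $(\alpha,\rho_m)$, $L''<0$, $\rho_0=\alpha$; - $\hat\rho=\rho_m$: root interval $\{\rho_m\}$, $\rho^*=\rho_m$; - $\rho_m<\hat\rho<\beta+C_2$: root interval $(\rho_m,\beta)$, $L''>0$, $\rho_0=\beta$; - $\hat\rho\ge\beta+C_2$: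 root interval $[\beta,+\infty)$, $\rho^*=\beta$. (C) Newton's method (for the equation $L(\rho)=0$) with the initial values $\rho_0$ listed in (B) is guaranteed to converge to the desired bounded solution $(\rho^*,\boldsymbol m^* )$, where $\boldsymbol m^*$ is obtained from $\rho^*$ as described in the context.
   Context: The action function associated with the mobility $M$ is $$\varphi(\rho,\boldsymbol m)=\begin{cases}\dfrac{\|\boldsymbol m\|^2}{M(\rho)}, & \text{if } M(\rho)>0,\\[4pt] 0, & \text{if } (M(\rho),\boldsymbol m)=(0,\boldsymbol 0),\\ +\infty, & \text{otherwise,}\end{cases}$$ where $\|\cdot\|$ is the Euclidean norm; values of $\rho$ outside the interval on which $M$ is considered ($[\alpha,\beta]$ for form (I), $[0,+\infty)$ for form (II)) fall under "otherwise". "Within the bounds" means that $\rho^*$ lies in that interval. In the region $M(\rho)>0$, the first-order optimality conditions of the minimization problem give $m_j=\dfrac{M(\rho)\mathcal D_{m_j}\hat m_j}{\mathcal D_{m_j}M(\rho)+\zeta}$ for $j=1,\dots,d$, and, after eliminating $\boldsymbol m$, the scalar equation $L(\rho)=0$ with $$L(\rho):=\mathcal D_\rho(\rho-\hat\rho)-\frac{\zeta M'(\rho)}{2}\sum_{j=1}^d\left(\frac{\mathcal D_{m_j}\hat m_j}{\mathcal D_{m_j}M(\rho)+\zeta}\right)^2 .$$ When $\xi=1$, $M$ is a polynomial and the same formula is used for $L$ at and beyond the endpoints where $M=0$. If $L$ has a root within the bounds, that root is $\rho^*$; otherwise $\rho^*$ is an endpoint at which $M=0$. The vector $\boldsymbol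 m^*$ is then obtained from $\rho^*$ by the relation for $m_j$ above (so $\boldsymbol m^*=\boldsymbol 0$ if $M(\rho^* )=0$). Newton's method is the iteration $\rho_{n+1}=\rho_n-L(\rho_n)/L'(\rho_n)$ started from $\rho_0$.
   Formalization: For m̂=0, L is affine, so these claims are dropped there: strict signs of L''; the root interval (ρ̂,∞); and, if ξ<1 and ρ̂ is at or beyond the nearer endpoint, the root interval and Newton claims. In (C), δ is sufficiently small depending on the input. *)

theory Defs
  imports "HOL-Analysis.Analysis"
begin

datatype mobility =
    Two_Sided (lower: real) (upper: real) (exponent: real)
  | One_Sided (exponent: real)

fun admissible :: "mobility \<Rightarrow> bool" where
  "admissible (Two_Sided \<alpha> \<beta> \<xi>) \<longleftrightarrow> \<alpha> < \<beta> \<and> 0 < \<xi> \<and> \<xi> \<le> 1"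
| "admissible (One_Sided \<xi>) \<longleftrightarrow> 0 < \<xi> \<and> \<xi> \<le> 1"

fun bounds :: "mobility \<Rightarrow> real set" where
  "bounds (Two_Sided \<alpha> \<beta> \<xi>) = {\<alpha>..\<beta>}"
| "bounds (One_Sided \<xi>) = {0..}"

text \<open>For exponent 1 the polynomial is used on the whole real line, because the scalar function
  below is then also considered outside the bounds, where the real power is meaningless. Inside the
  bounds both branches agree at exponent 1.\<close>

fun mob :: "mobility \<Rightarrow> real \<Rightarrow> real" where
  "mob (Two_Sided \<alpha> \<beta> \<xi>) \<rho> =
     (if \<xi> = 1 then (\<rho> - \<alpha>) * (\<beta> - \<rho>) else (\<rho> - \<alpha>) powr \<xi> * (\<beta> - \<rho>) powr \<xi>)"
| "mob (One_Sided \<xi>) \<rho> = (if \<xi> = 1 then \<rho> else \<rho> powr \<xi>)"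

definition action :: "mobility \<Rightarrow> real \<Rightarrow> real ^ 'd \<Rightarrow> ereal" where
  "action F \<rho> m =
     (if \<rho> \<in> bounds F \<and> mob F \<rho> > 0 then ereal ((norm m)\<^sup>2 / mob F \<rho>)
      else if \<rho> \<in> bounds F \<and> mob F \<rho> = 0 \<and> m = 0 then 0
      else \<infinity>)"

definition objective ::
  "mobility \<Rightarrow> real \<Rightarrow> real ^ 'd \<Rightarrow> real \<Rightarrow> real \<Rightarrow> real ^ 'd \<Rightarrow> real \<times> (real ^ 'd) \<Rightarrow> ereal" where
  "objective F D\<^sub>\<rho> D\<^sub>m \<zeta> \<rho>h mh = (\<lambda>(\<rho>, m).
     ereal (1/2 * D\<^sub>\<rho> * (\<rho> - \<rho>h)\<^sup>2 + 1/2 * (\<Sum>j\<in>UNIV. D\<^sub>m $ j * (m $ j - mh $ j)\<^sup>2))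
     + ereal (\<zeta> / 2) * action F \<rho> m)"

definition momentum :: "mobility \<Rightarrow> real ^ 'd \<Rightarrow> real \<Rightarrow> real ^ 'd \<Rightarrow> real \<Rightarrow> real ^ 'd" where
  "momentum F D\<^sub>m \<zeta> mh \<rho> =
     (\<chi> j. mob F \<rho> * D\<^sub>m $ j * mh $ j / (D\<^sub>m $ j * mob F \<rho> + \<zeta>))"

definition scalar_fun ::
  "mobility \<Rightarrow> real \<Rightarrow> real ^ 'd \<Rightarrow> real \<Rightarrow> real \<Rightarrow> real ^ 'd \<Rightarrow> real \<Rightarrow> real" where
  "scalar_fun F D\<^sub>\<rho> D\<^sub>m \<zeta> \<rho>h mh \<rho> =
     D\<^sub>\<rho> * (\<rho> - \<rho>h)
     - \<zeta> * deriv (mob F) \<rho> / 2 * (\<Sum>j\<in>UNIV. (D\<^sub>m $ j * mh $ j / (D\<^sub>m $ j * mob F \<rho> + \<zeta>))\<^sup>2)"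

text \<open>The points at which the formula for the scalar function is meaningful: the region of positive
  mobility and, for exponent 1, all real points that are not poles. A summand with
  \<open>mh $ j = 0\<close> is the zero function and contributes no pole.\<close>

definition scalar_dom :: "mobility \<Rightarrow> real ^ 'd \<Rightarrow> real \<Rightarrow> real ^ 'd \<Rightarrow> real set" where
  "scalar_dom F D\<^sub>m \<zeta> mh =
     {\<rho>. (\<rho> \<in> bounds F \<and> mob F \<rho> > 0)
         \<or> (exponent F = 1 \<and> (\<forall>j. mh $ j \<noteq> 0 \<longrightarrow> D\<^sub>m $ j * mob F \<rho> + \<zeta> \<noteq> 0))}"

definition second_deriv_neg :: "(real \<Rightarrow> real) \<Rightarrow> real set \<Rightarrow> bool" where
  "second_deriv_neg f I \<longleftrightarrow>
     (\<forall>x\<in>I. f differentiable at x \<and> deriv f differentiable at x \<and> deriv (deriv f) x < 0)"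

definition second_deriv_pos :: "(real \<Rightarrow> real) \<Rightarrow> real set \<Rightarrow> bool" where
  "second_deriv_pos f I \<longleftrightarrow>
     (\<forall>x\<in>I. f differentiable at x \<and> deriv f differentiable at x \<and> deriv (deriv f) x > 0)"

definition newton :: "(real \<Rightarrow> real) \<Rightarrow> real \<Rightarrow> nat \<Rightarrow> real" where
  "newton f x0 n = ((\<lambda>x. x - f x / deriv f x) ^^ n) x0"

text \<open>Division by zero and the derivative of a non-differentiable function have dummy values, so
  convergence includes that every step of the iteration is well defined.\<close>

definition newton_converges :: "(real \<Rightarrow> real) \<Rightarrow> real set \<Rightarrow> real \<Rightarrow> real \<Rightarrow> bool" where
  "newton_converges f S x0 x \<longleftrightarrow>
     (\<forall>n. newton f x0 n \<in> S \<and> f differentiable at (newton f x0 n) \<and> deriv f (newton f x0 n) \<noteq> 0)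
     \<and> newton f x0 \<longlonglongrightarrow> x"

end

theory Submission
  imports Defs
begin

text \<open>Minimising over the momentum first, by completing the square, leaves a function of the density
  alone which is strictly convex because the mobility is concave; its derivative is the scalar
  function \<open>L\<close>, and \<open>L' \<ge> D\<^sub>\<rho> > 0\<close> on the bounds. So the minimiser is the
  point where \<open>L\<close> changes sign, and all location claims are read off from the sign of \<open>L\<close> near the
  endpoints and at the midpoint. Up to a positive factor each summand of \<open>L''\<close> is the third
  derivative of \<open>1/u\<close> with \<open>u = D M + \<zeta>\<close>, which is negative where \<open>M' > 0\<close>, \<open>M'' \<le> 0\<close> and
  \<open>M''' \<ge> 0\<close>. There \<open>L\<close> is increasing and concave, so Newton's method increases to the root from
  any point to the left of it. The right half of a two-sided mobility follows by the reflection
  \<open>x \<mapsto> \<alpha> + \<beta> - x\<close>: it fixes the mobility and turns \<open>L\<close> into \<open>- L\<close> for the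
  reflected input.\<close>

section \<open>Newton's method for concave increasing functions, and reflections\<close>

text \<open>Two features shape the argument. For exponents below 1 the mobility has infinite slope
  at an endpoint, so \<open>L\<close> has no value there; near the left end it tends to minus
  infinity as soon as \<open>mh\<close> is nonzero, which forces an interior root and makes a start
  at distance \<delta> necessary. For exponent 1 everything is polynomial: \<open>L\<close> extends
  past the endpoints, the start may be the endpoint itself, and the thresholds express the sign of
  \<open>L\<close> there. This extension has poles where \<open>D M + \<zeta> = 0\<close>, so the
  root beyond an endpoint needs its own argument, which follows \<open>L\<close> down towards the
  first pole. The case \<open>mh = 0\<close> is degenerate: \<open>L\<close> is affine with root
  \<rho>h, and the minimiser is the projection of \<rho>h to the bounds, possibly an endpoint even
  for exponents below 1. Sign statements are therefore kept weak wherever this case has to pass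
  through.\<close>

lemma newton_Suc: "newton f x0 (Suc n) = newton f x0 n - f (newton f x0 n) / deriv f (newton f x0 n)"
  by (simp add: newton_def)

text \<open>For concave \<open>f\<close> the tangent at a point left of the root lies above the
  graph and reaches zero no later than the graph does, so the iterates increase and never pass
  \<open>s\<close>; only the interval from \<open>a\<close> to \<open>s\<close> is visited.
  Concavity is stated as weak monotonicity of \<open>f'\<close>, so that an affine \<open>f\<close>
  is covered.\<close>

lemma newton_concave_increasing:
  fixes f f' :: "real \<Rightarrow> real"
  assumes "a \<le> s" and root: "f s = 0"
    and der: "\<And>x. a \<le> x \<Longrightarrow> x \<le> s \<Longrightarrow> (f has_real_derivative f' x) (at x)"
    and pos: "\<And>x. a \<le> x \<Longrightarrow> x \<le> s \<Longrightarrow> f' x > 0"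
    and dec: "\<And>x y. a \<le> x \<Longrightarrow> x \<le> y \<Longrightarrow> y \<le> s \<Longrightarrow> f' y \<le> f' x"
  shows "\<And>n. newton f a n \<in> {a..s}" and "newton f a \<longlonglongrightarrow> s"
proof -
  define X where "X = newton f a"
  have X_Suc: "X (Suc n) = X n - f (X n) / deriv f (X n)" for n
    unfolding X_def by (rule newton_Suc)
  have dv: "deriv f x = f' x" if "x \<in> {a..s}" for x
    using der that by (auto intro: DERIV_imp_deriv)
  \<comment> \<open>By the mean value theorem the slope of the chord from \<open>x\<close> to
    \<open>s\<close> is some \<open>f' z\<close> with \<open>z > x\<close>, hence at most the
    tangent slope \<open>f' x\<close>.\<close>
  have gap: "0 \<le> - f x \<and> - f x \<le> f' x * (s - x)" if x: "x \<in> {a..s}" for x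
  proof (cases "x = s")
    case False
    then have "x < s" using x by auto
    then obtain z where z: "x < z" "z < s" "f s - f x = (s - x) * f' z"
      using MVT2[of x s f f'] der x by auto
    then have "- f x = f' z * (s - x)" using root by (simp add: algebra_simps)
    moreover have "0 < f' z" "f' z \<le> f' x" using pos dec z x by auto
    ultimately show ?thesis using \<open>x < s\<close> by (simp add: mult_right_mono)
  qed (use root in simp)
  have step: "x \<le> x - f x / f' x \<and> x - f x / f' x \<le> s" if x: "x \<in> {a..s}" for x
    using gap[OF x] pos[of x] x by (simp add: field_simps divide_nonpos_pos)
  have X_in: "X n \<in> {a..s}" for n
  proof (induction n)
    case 0
    then show ?case using \<open>a \<le> s\<close> by (simp add: X_def newton_def)
  next
    case (Suc n)
    then show ?case using step[OF Suc] dv[OF Suc] by (auto simp: X_Suc)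
  qed
  then show "\<And>n. newton f a n \<in> {a..s}" by (simp add: X_def)
  have "incseq X"
    using step X_in dv by (intro incseq_SucI) (simp add: X_Suc)
  moreover have "\<forall>n. X n \<le> s" using X_in by auto
  ultimately obtain l where l: "X \<longlonglongrightarrow> l" by (elim incseq_convergent) auto
  have l_in: "l \<in> {a..s}"
    using closed_sequentially[of "{a..s}" X l] X_in l by auto
  \<comment> \<open>The residual \<open>- f (X n)\<close> is slope times step length. The slope is
    at most \<open>f' a\<close>, and the steps of a convergent sequence tend to zero.\<close>
  have "(\<lambda>n. f' a * (X (Suc n) - X n)) \<longlonglongrightarrow> f' a * (l - l)"
    by (intro tendsto_intros l LIMSEQ_Suc)
  moreover have "- f (X n) \<le> f' a * (X (Suc n) - X n)" "0 \<le> - f (X n)" for n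
  proof -
    have "- f (X n) = f' (X n) * (X (Suc n) - X n)"
      using pos[of "X n"] X_in[of n] by (simp add: X_Suc dv)
    also have "\<dots> \<le> f' a * (X (Suc n) - X n)"
      using dec[of a "X n"] X_in[of n] \<open>incseq X\<close> by (intro mult_right_mono) (auto simp: incseq_SucD)
    finally show "- f (X n) \<le> f' a * (X (Suc n) - X n)" .
    show "0 \<le> - f (X n)" using gap[OF X_in] by blast
  qed
  ultimately have "(\<lambda>n. - f (X n)) \<longlonglongrightarrow> 0"
    using tendsto_sandwich[of "\<lambda>_. 0" "\<lambda>n. - f (X n)" sequentially "\<lambda>n. f' a * (X (Suc n) - X n)" 0]
    by simp
  moreover have "(\<lambda>n. - f (X n)) \<longlonglongrightarrow> - f l"
    using l der[of l] l_in by (intro tendsto_minus isCont_tendsto_compose[of l f X]) (auto intro: DERIV_isCont)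
  ultimately have "f l = 0" using LIMSEQ_unique by fastforce
  have "l = s"
  proof (rule ccontr)
    assume "l \<noteq> s"
    then have "l < s" using l_in by auto
    then have "f l < f s"
    proof (rule DERIV_pos_imp_increasing)
      fix x assume "l \<le> x" "x \<le> s"
      then have "a \<le> x" "x \<le> s" using l_in by auto
      then show "\<exists>y. (f has_real_derivative y) (at x) \<and> 0 < y" using der pos by blast
    qed
    then show False using root \<open>f l = 0\<close> by simp
  qed
  then show "newton f a \<longlonglongrightarrow> s" using l by (simp add: X_def)
qed

text \<open>The minus sign in front and the one from the chain rule cancel, so the derivative is
  kept. The identity is asked on an open set because \<open>L_reflect\<close> provides it only on
  \<open>regular F\<close>.\<close>

lemma DERIV_odd_reflect:
  fixes f g :: "real \<Rightarrow> real"
  assumes "(g has_real_derivative D) (at (c - x))"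
    and "open T" "x \<in> T" "\<And>y. y \<in> T \<Longrightarrow> f y = - g (c - y)"
  shows "(f has_real_derivative D) (at x)"
proof -
  have "((\<lambda>y. - g (c - y)) has_real_derivative - (D * (0 - 1))) (at x)"
    using assms(1) by (intro DERIV_minus DERIV_chain2[of g] derivative_intros)
  then show ?thesis
    using has_field_derivative_transform_within_open[OF _ assms(2,3)] assms(4) by force
qed

text \<open>Reflection flips the value and keeps the derivative, so the Newton step commutes with
  \<open>x \<mapsto> c - x\<close> and the two iterations are mirror images, including the
  well-definedness of every step.\<close>

lemma newton_converges_reflect:
  fixes f g :: "real \<Rightarrow> real"
  assumes conv: "newton_converges g S x0 s" and "open T"
    and S: "\<And>x. x \<in> S \<Longrightarrow> c - x \<in> S \<inter> T"
    and fg: "\<And>y. y \<in> T \<Longrightarrow> f y = - g (c - y)"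
  shows "newton f (c - x0) = (\<lambda>n. c - newton g x0 n)" and "newton_converges f S (c - x0) (c - s)"
proof -
  have g: "newton g x0 n \<in> S" "(g has_real_derivative deriv g (newton g x0 n)) (at (newton g x0 n))"
    "deriv g (newton g x0 n) \<noteq> 0" "newton g x0 \<longlonglongrightarrow> s" for n
    using conv unfolding newton_converges_def
    by (auto simp: DERIV_deriv_iff_real_differentiable)
  have f: "(f has_real_derivative deriv g (newton g x0 n)) (at (c - newton g x0 n))" for n
  proof (rule DERIV_odd_reflect[where g = g and c = c and T = T])
    show "(g has_real_derivative deriv g (newton g x0 n)) (at (c - (c - newton g x0 n)))"
      using g(2)[of n] by simp
    show "c - newton g x0 n \<in> T" using S[OF g(1)] by blast
  qed (use \<open>open T\<close> fg in auto)
  have eq: "newton f (c - x0) n = c - newton g x0 n" for n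
  proof (induction n)
    case 0
    then show ?case by (simp add: newton_def)
  next
    case (Suc n)
    have "f (c - newton g x0 n) = - g (newton g x0 n)" using fg S[OF g(1)] by simp
    then show ?case using DERIV_imp_deriv[OF f[of n]] by (simp add: newton_Suc Suc)
  qed
  then show seq: "newton f (c - x0) = (\<lambda>n. c - newton g x0 n)" by (rule ext)
  show "newton_converges f S (c - x0) (c - s)"
    unfolding newton_converges_def seq
  proof (intro conjI allI)
    fix n
    show "c - newton g x0 n \<in> S" using S[OF g(1)] by blast
    show "f differentiable at (c - newton g x0 n)" using f real_differentiable_def by blast
    show "deriv f (c - newton g x0 n) \<noteq> 0" using DERIV_imp_deriv[OF f[of n]] g(3) by simp
  qed (intro tendsto_intros g(4))
qed

text \<open>The first derivative of \<open>f\<close> at \<open>x\<close> is that of \<open>g\<close>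
  at \<open>c - x\<close>; differentiating once more brings in the sign that turns negative into
  positive.\<close>

lemma second_deriv_pos_reflect:
  fixes f g :: "real \<Rightarrow> real"
  assumes neg: "second_deriv_neg g I" and "open J"
    and I: "\<And>x. x \<in> J \<Longrightarrow> c - x \<in> I" and fg: "\<And>y. y \<in> J \<Longrightarrow> f y = - g (c - y)"
  shows "second_deriv_pos f J"
proof -
  have f: "(f has_real_derivative deriv g (c - x)) (at x)" if "x \<in> J" for x
    using that neg I fg \<open>open J\<close> unfolding second_deriv_neg_def
    by (intro DERIV_odd_reflect[of g _ c x J f]) (auto simp: DERIV_deriv_iff_real_differentiable)
  have f': "(deriv f has_real_derivative - deriv (deriv g) (c - x)) (at x)" if "x \<in> J" for x
  proof (rule DERIV_odd_reflect[of "\<lambda>x. - deriv g x" _ c x J])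
    have "(deriv g has_real_derivative deriv (deriv g) (c - x)) (at (c - x))"
      using that neg I unfolding second_deriv_neg_def by (simp add: DERIV_deriv_iff_real_differentiable)
    then show "((\<lambda>x. - deriv g x) has_real_derivative - deriv (deriv g) (c - x)) (at (c - x))"
      by (rule DERIV_minus)
  qed (use that \<open>open J\<close> f in \<open>auto simp: DERIV_imp_deriv\<close>)
  show ?thesis
    unfolding second_deriv_pos_def
  proof (intro ballI conjI)
    fix x assume x: "x \<in> J"
    show "f differentiable at x" "deriv f differentiable at x"
      using f[OF x] f'[OF x] real_differentiable_def by blast+
    show "0 < deriv (deriv f) x"
      using DERIV_imp_deriv[OF f'[OF x]] neg I x unfolding second_deriv_neg_def by auto
  qed
qed

section \<open>Mobilities\<close>

text \<open>The set on which the formula for the mobility is smooth. It contains the endpoints, and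
  everything beyond them, exactly when the mobility is a polynomial.\<close>

fun regular :: "mobility \<Rightarrow> real set" where
  "regular (Two_Sided \<alpha> \<beta> \<xi>) = (if \<xi> = 1 then UNIV else {\<alpha><..<\<beta>})"
| "regular (One_Sided \<xi>) = (if \<xi> = 1 then UNIV else {0<..})"

fun open_bounds :: "mobility \<Rightarrow> real set" where
  "open_bounds (Two_Sided \<alpha> \<beta> \<xi>) = {\<alpha><..<\<beta>}"
| "open_bounds (One_Sided \<xi>) = {0<..}"

fun left_end :: "mobility \<Rightarrow> real" where
  "left_end (Two_Sided \<alpha> \<beta> \<xi>) = \<alpha>"
| "left_end (One_Sided \<xi>) = 0"

text \<open>For a two-sided mobility the two powers are merged into one power of the quadratic
  \<open>(x - \<alpha>) * (\<beta> - x)\<close>, so a single chain rule serves all three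
  derivatives. Exponent 1 gets its own branch: at the endpoints the general formula would contain
  \<open>0 powr 0\<close>, which is 0, although the polynomial has nonzero slope there.\<close>

fun mob1 :: "mobility \<Rightarrow> real \<Rightarrow> real" where
  "mob1 (Two_Sided \<alpha> \<beta> \<xi>) x =
     (if \<xi> = 1 then \<alpha> + \<beta> - 2 * x
      else \<xi> * ((x - \<alpha>) * (\<beta> - x)) powr (\<xi> - 1) * (\<alpha> + \<beta> - 2 * x))"
| "mob1 (One_Sided \<xi>) x = (if \<xi> = 1 then 1 else \<xi> * x powr (\<xi> - 1))"

fun mob2 :: "mobility \<Rightarrow> real \<Rightarrow> real" where
  "mob2 (Two_Sided \<alpha> \<beta> \<xi>) x =
     (if \<xi> = 1 then - 2
      else \<xi> * (\<xi> - 1) * ((x - \<alpha>) * (\<beta> - x)) powr (\<xi> - 2) * (\<alpha> + \<beta> - 2 * x)\<^sup>2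
           - 2 * \<xi> * ((x - \<alpha>) * (\<beta> - x)) powr (\<xi> - 1))"
| "mob2 (One_Sided \<xi>) x = (if \<xi> = 1 then 0 else \<xi> * (\<xi> - 1) * x powr (\<xi> - 2))"

fun mob3 :: "mobility \<Rightarrow> real \<Rightarrow> real" where
  "mob3 (Two_Sided \<alpha> \<beta> \<xi>) x =
     (if \<xi> = 1 then 0
      else \<xi> * (\<xi> - 1) * (\<xi> - 2) * ((x - \<alpha>) * (\<beta> - x)) powr (\<xi> - 3) * (\<alpha> + \<beta> - 2 * x) ^ 3
           - 6 * \<xi> * (\<xi> - 1) * ((x - \<alpha>) * (\<beta> - x)) powr (\<xi> - 2) * (\<alpha> + \<beta> - 2 * x))"
| "mob3 (One_Sided \<xi>) x = (if \<xi> = 1 then 0 else \<xi> * (\<xi> - 1) * (\<xi> - 2) * x powr (\<xi> - 3))"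

lemma open_regular: "open (regular F)"
  by (cases F) auto

lemma open_bounds_subset_regular: "open_bounds F \<subseteq> regular F"
  by (cases F) auto

lemma open_bounds_subset_bounds: "open_bounds F \<subseteq> bounds F"
  by (cases F) auto

section \<open>Differentiation of the mobilities\<close>

lemma DERIV_poly_powr:
  fixes x :: real
  assumes "(x - \<alpha>) * (\<beta> - x) > 0"
  shows "((\<lambda>x. ((x - \<alpha>) * (\<beta> - x)) powr r) has_real_derivative
           r * ((x - \<alpha>) * (\<beta> - x)) powr (r - 1) * (\<alpha> + \<beta> - 2 * x)) (at x)"
proof -
  have "((\<lambda>x. (x - \<alpha>) * (\<beta> - x)) has_real_derivative \<alpha> + \<beta> - 2 * x) (at x)"
    by (auto intro!: derivative_eq_intros simp: algebra_simps)
  then show ?thesis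
    using DERIV_chain2[where f = "\<lambda>z. z powr r" and g = "\<lambda>x. (x - \<alpha>) * (\<beta> - x)",
        OF has_real_derivative_powr[OF assms]] by simp
qed

lemma DERIV_mob:
  assumes "x \<in> regular F"
  shows "(mob F has_real_derivative mob1 F x) (at x)"
proof (cases F)
  case F: (Two_Sided \<alpha> \<beta> \<xi>)
  show ?thesis
  proof (cases "\<xi> = 1")
    case True
    then have "mob F = (\<lambda>x. (x - \<alpha>) * (\<beta> - x))" by (auto simp: F)
    then show ?thesis
      using True by (auto simp: F algebra_simps intro!: derivative_eq_intros)
  next
    case False
    then have x: "x \<in> {\<alpha><..<\<beta>}" using assms F by simp
    show ?thesis
    proof (rule has_field_derivative_transform_within_open[OF _ _ x])
      show "((\<lambda>x. ((x - \<alpha>) * (\<beta> - x)) powr \<xi>) has_real_derivative mob1 F x) (at x)"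
        using DERIV_poly_powr[of x \<alpha> \<beta> \<xi>] x False by (simp add: F)
    qed (use False in \<open>auto simp: F powr_mult\<close>)
  qed
next
  case F: (One_Sided \<xi>)
  show ?thesis
  proof (cases "\<xi> = 1")
    case True
    then have "mob F = (\<lambda>x. x)" by (auto simp: F)
    then show ?thesis using True by (simp add: F)
  next
    case False
    then have "mob F = (\<lambda>x. x powr \<xi>)" by (auto simp: F)
    then show ?thesis using False assms has_real_derivative_powr[of x \<xi>] by (simp add: F)
  qed
qed

lemma DERIV_mob1:
  assumes "x \<in> regular F"
  shows "(mob1 F has_real_derivative mob2 F x) (at x)"
proof (cases F)
  case F: (Two_Sided \<alpha> \<beta> \<xi>)
  show ?thesis
  proof (cases "\<xi> = 1")
    case True
    then have "mob1 F = (\<lambda>x. \<alpha> + \<beta> - 2 * x)" by (auto simp: F)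
    then show ?thesis
      using True by (auto simp: F intro!: derivative_eq_intros)
  next
    case False
    then have eq: "mob1 F = (\<lambda>x. \<xi> * ((x - \<alpha>) * (\<beta> - x)) powr (\<xi> - 1) * (\<alpha> + \<beta> - 2 * x))"
      by (auto simp: F)
    have "0 < (x - \<alpha>) * (\<beta> - x)" using assms F False by simp
    note p = DERIV_poly_powr[OF this, of "\<xi> - 1"]
    have "((\<lambda>x. \<alpha> + \<beta> - 2 * x) has_real_derivative - 2) (at x)"
      by (auto intro!: derivative_eq_intros)
    from DERIV_mult[OF DERIV_cmult[OF p, of \<xi>] this] show ?thesis
      unfolding eq by (rule DERIV_cong) (use False in \<open>simp add: F power2_eq_square\<close>)
  qed
next
  case F: (One_Sided \<xi>)
  show ?thesis
  proof (cases "\<xi> = 1")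
    case True
    then have "mob1 F = (\<lambda>x. 1)" by (auto simp: F)
    then show ?thesis using True by (simp add: F)
  next
    case False
    then have "mob1 F = (\<lambda>x. \<xi> * x powr (\<xi> - 1))" by (auto simp: F)
    then show ?thesis
      using False assms DERIV_cmult[OF has_real_derivative_powr[of x "\<xi> - 1"], of \<xi>]
      by (simp add: F algebra_simps)
  qed
qed

lemma DERIV_mob2:
  assumes "x \<in> regular F"
  shows "(mob2 F has_real_derivative mob3 F x) (at x)"
proof (cases F)
  case F: (Two_Sided \<alpha> \<beta> \<xi>)
  show ?thesis
  proof (cases "\<xi> = 1")
    case True
    then have "mob2 F = (\<lambda>x. - 2)" by (auto simp: F)
    then show ?thesis
      using True by (auto simp: F)
  next
    case False
    define p where "p = (\<lambda>x. (x - \<alpha>) * (\<beta> - x))"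
    have eq: "mob2 F = (\<lambda>x. \<xi> * (\<xi> - 1) * p x powr (\<xi> - 2) * (\<alpha> + \<beta> - 2 * x)\<^sup>2
           - 2 * \<xi> * p x powr (\<xi> - 1))"
      using False by (auto simp: F p_def)
    have "0 < (x - \<alpha>) * (\<beta> - x)" using assms F False by simp
    from DERIV_poly_powr[OF this] have p:
      "((\<lambda>x. p x powr r) has_real_derivative r * p x powr (r - 1) * (\<alpha> + \<beta> - 2 * x)) (at x)" for r
      by (simp add: p_def)
    have "((\<lambda>x. (\<alpha> + \<beta> - 2 * x)\<^sup>2) has_real_derivative - 4 * (\<alpha> + \<beta> - 2 * x)) (at x)"
      by (auto intro!: derivative_eq_intros)
    from DERIV_diff[OF DERIV_mult[OF DERIV_cmult[OF p, of "\<xi> * (\<xi> - 1)" "\<xi> - 2"] this]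
        DERIV_cmult[OF p, of "2 * \<xi>" "\<xi> - 1"]]
    have "(mob2 F has_real_derivative
        \<xi> * (\<xi> - 1) * ((\<xi> - 2) * p x powr (\<xi> - 3) * (\<alpha> + \<beta> - 2 * x)) * (\<alpha> + \<beta> - 2 * x)\<^sup>2
        + - 4 * (\<alpha> + \<beta> - 2 * x) * (\<xi> * (\<xi> - 1) * p x powr (\<xi> - 2))
        - 2 * \<xi> * ((\<xi> - 1) * p x powr (\<xi> - 2) * (\<alpha> + \<beta> - 2 * x))) (at x)"
      unfolding eq by simp
    moreover have "mob3 F x =
        \<xi> * (\<xi> - 1) * (\<xi> - 2) * p x powr (\<xi> - 3) * (\<alpha> + \<beta> - 2 * x) ^ 3
        - 6 * \<xi> * (\<xi> - 1) * p x powr (\<xi> - 2) * (\<alpha> + \<beta> - 2 * x)"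
      using False by (simp add: F p_def)
    ultimately show ?thesis
      by (elim DERIV_cong) algebra
  qed
next
  case F: (One_Sided \<xi>)
  show ?thesis
  proof (cases "\<xi> = 1")
    case True
    then have "mob2 F = (\<lambda>x. 0)" by (auto simp: F)
    then show ?thesis using True by (simp add: F)
  next
    case False
    then have "mob2 F = (\<lambda>x. \<xi> * (\<xi> - 1) * x powr (\<xi> - 2))" by (auto simp: F)
    then show ?thesis
      using False assms DERIV_cmult[OF has_real_derivative_powr[of x "\<xi> - 2"], of "\<xi> * (\<xi> - 1)"]
      by (simp add: F algebra_simps)
  qed
qed

section \<open>Continuity, positivity and concavity of the mobilities\<close>

lemma continuous_on_mob:
  assumes "admissible F"
  shows "continuous_on (bounds F) (mob F)"
proof (cases F)
  case F: (Two_Sided \<alpha> \<beta> \<xi>)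
  then have "mob F = (if \<xi> = 1 then (\<lambda>x. (x - \<alpha>) * (\<beta> - x)) else (\<lambda>x. (x - \<alpha>) powr \<xi> * (\<beta> - x) powr \<xi>))"
    by auto
  then show ?thesis using assms F
    by (auto intro!: continuous_intros continuous_on_powr')
next
  case F: (One_Sided \<xi>)
  then have "mob F = (if \<xi> = 1 then (\<lambda>x. x) else (\<lambda>x. x powr \<xi>))"
    by auto
  then show ?thesis using assms F
    by (auto intro!: continuous_intros continuous_on_powr')
qed

lemma mob_nonneg: "x \<in> bounds F \<Longrightarrow> mob F x \<ge> 0"
  by (cases F) auto

lemma mob_pos_iff:
  assumes "admissible F" "x \<in> bounds F"
  shows "mob F x > 0 \<longleftrightarrow> x \<in> open_bounds F"
  using assms by (cases F) (auto simp: zero_less_mult_iff order.order_iff_strict)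

lemma mob2_nonpos:
  assumes "admissible F"
  shows "mob2 F x \<le> 0"
proof (cases F)
  case F: (Two_Sided \<alpha> \<beta> \<xi>)
  have "\<xi> * (\<xi> - 1) \<le> 0" "0 \<le> \<xi>" using assms F by (auto intro!: mult_nonneg_nonpos)
  then have "\<xi> * (\<xi> - 1) * ((x - \<alpha>) * (\<beta> - x)) powr (\<xi> - 2) * (\<alpha> + \<beta> - 2 * x)\<^sup>2 \<le> 0"
    "0 \<le> 2 * \<xi> * ((x - \<alpha>) * (\<beta> - x)) powr (\<xi> - 1)"
    by (auto intro!: mult_nonpos_nonneg)
  then show ?thesis by (simp add: F)
next
  case F: (One_Sided \<xi>)
  have "\<xi> * (\<xi> - 1) \<le> 0" using assms F by (auto intro!: mult_nonneg_nonpos)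
  then have "\<xi> * (\<xi> - 1) * x powr (\<xi> - 2) \<le> 0" by (rule mult_nonpos_nonneg) simp
  then show ?thesis by (simp add: F)
qed

text \<open>Since \<open>0 < \<xi> \<le> 1\<close>, the factor \<open>\<xi> * (\<xi> - 1)\<close> is
  nonpositive and \<open>\<xi> * (\<xi> - 1) * (\<xi> - 2)\<close> is nonnegative. In the two-sided
  case both terms then have the right sign once \<open>\<alpha> + \<beta> - 2 * x \<ge> 0\<close>,
  which a positive slope implies.\<close>

lemma mob3_nonneg:
  assumes "admissible F" "x \<in> regular F" "mob1 F x > 0"
  shows "mob3 F x \<ge> 0"
proof (cases F)
  case F: (Two_Sided \<alpha> \<beta> \<xi>)
  show ?thesis
  proof (cases "\<xi> = 1")
    case False
    define p where "p = (x - \<alpha>) * (\<beta> - x)"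
    have "0 \<le> \<alpha> + \<beta> - 2 * x"
      using assms F False
        mult_nonneg_nonpos[of "\<xi> * ((x - \<alpha>) * (\<beta> - x)) powr (\<xi> - 1)" "\<alpha> + \<beta> - 2 * x"]
      by force
    moreover have "0 \<le> \<xi> * (\<xi> - 1) * (\<xi> - 2)" "\<xi> * (\<xi> - 1) \<le> 0"
      using assms F by (auto intro!: mult_nonpos_nonpos mult_nonneg_nonpos)
    ultimately have "0 \<le> \<xi> * (\<xi> - 1) * (\<xi> - 2) * (p powr (\<xi> - 3) * (\<alpha> + \<beta> - 2 * x) ^ 3)"
      "\<xi> * (\<xi> - 1) * (6 * p powr (\<xi> - 2) * (\<alpha> + \<beta> - 2 * x)) \<le> 0"
      using mult_nonneg_nonneg[of "\<xi> * (\<xi> - 1) * (\<xi> - 2)" "p powr (\<xi> - 3) * (\<alpha> + \<beta> - 2 * x) ^ 3"]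
        mult_nonpos_nonneg[of "\<xi> * (\<xi> - 1)" "6 * p powr (\<xi> - 2) * (\<alpha> + \<beta> - 2 * x)"]
      by simp_all
    moreover have "mob3 F x = \<xi> * (\<xi> - 1) * (\<xi> - 2) * (p powr (\<xi> - 3) * (\<alpha> + \<beta> - 2 * x) ^ 3)
        - \<xi> * (\<xi> - 1) * (6 * p powr (\<xi> - 2) * (\<alpha> + \<beta> - 2 * x))"
      using False by (simp add: F p_def)
    ultimately show ?thesis by linarith
  qed (simp add: F)
next
  case F: (One_Sided \<xi>)
  then show ?thesis
    using assms by (auto intro!: mult_nonneg_nonneg mult_nonpos_nonpos[of "\<xi> * (\<xi> - 1)"] mult_nonneg_nonpos[of \<xi>])
qed

text \<open>The part of the smooth region on which the mobility increases; by the symmetry of the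
  two-sided mobilities it suffices to study the problem there.\<close>

fun rising :: "mobility \<Rightarrow> real set" where
  "rising (Two_Sided \<alpha> \<beta> \<xi>) = {x. (if \<xi> = 1 then \<alpha> \<le> x else \<alpha> < x) \<and> x < (\<alpha> + \<beta>) / 2}"
| "rising (One_Sided \<xi>) = {x. if \<xi> = 1 then 0 \<le> x else 0 < x}"

lemma rising_subset: "admissible F \<Longrightarrow> rising F \<subseteq> regular F \<inter> bounds F"
  by (cases F) auto

lemma rising_between: "x \<in> rising F \<Longrightarrow> y \<in> rising F \<Longrightarrow> x \<le> z \<Longrightarrow> z \<le> y \<Longrightarrow> z \<in> rising F"
  by (cases F) (auto split: if_splits)

lemma regular_bounds_between:
  "x \<in> regular F \<inter> bounds F \<Longrightarrow> y \<in> regular F \<inter> bounds F \<Longrightarrow> x \<le> z \<Longrightarrow> z \<le> y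
    \<Longrightarrow> z \<in> regular F \<inter> bounds F"
  by (cases F) (auto split: if_splits)

lemma open_bounds_between:
  "x \<in> bounds F \<Longrightarrow> y \<in> bounds F \<Longrightarrow> x < z \<Longrightarrow> z < y \<Longrightarrow> z \<in> open_bounds F"
  by (cases F) auto

lemma mob1_pos:
  assumes "admissible F" "x \<in> rising F"
  shows "mob1 F x > 0"
proof (cases F)
  case (Two_Sided \<alpha> \<beta> \<xi>)
  then show ?thesis using assms by (auto simp: zero_less_mult_iff)
qed (use assms in auto)

section \<open>Behaviour at the left endpoint\<close>

lemma left_end_in_bounds: "admissible F \<Longrightarrow> left_end F \<in> bounds F"
  by (cases F) auto

lemma left_end_le: "x \<in> bounds F \<Longrightarrow> left_end F \<le> x"
  by (cases F) auto

lemma left_end_less: "x \<in> open_bounds F \<Longrightarrow> left_end F < x"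
  by (cases F) auto

lemma mob_left_end: "admissible F \<Longrightarrow> mob F (left_end F) = 0"
  by (cases F) auto

lemma eventually_at_right_left_end:
  assumes "admissible F"
  shows "eventually (\<lambda>x. x \<in> open_bounds F \<inter> rising F) (at_right (left_end F))"
proof (cases F)
  case (Two_Sided \<alpha> \<beta> \<xi>)
  then have "\<alpha> < (\<alpha> + \<beta>) / 2" using assms by simp
  then have "eventually (\<lambda>x. x \<in> {\<alpha><..<(\<alpha> + \<beta>) / 2}) (at_right \<alpha>)"
    by (rule eventually_at_right_real)
  then have "eventually (\<lambda>x. x \<in> open_bounds F \<inter> rising F) (at_right \<alpha>)"
    by (rule eventually_mono) (use Two_Sided assms in auto)
  then show ?thesis by (simp add: Two_Sided)
next
  case (One_Sided \<xi>)
  have "eventually (\<lambda>x::real. x \<in> {0<..<1}) (at_right 0)"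
    by (rule eventually_at_right_real) simp
  then show ?thesis by (simp add: One_Sided eventually_mono)
qed

lemma tendsto_mob_left_end:
  assumes "admissible F"
  shows "(mob F \<longlongrightarrow> 0) (at_right (left_end F))"
proof -
  obtain b where b: "left_end F < b" "{left_end F..b} \<subseteq> bounds F"
    using assms by (cases F) (auto intro: that[of 1])
  have "continuous_on {left_end F..b} (mob F)"
    using continuous_on_mob[OF assms] b(2) by (rule continuous_on_subset)
  from continuous_on_Icc_at_rightD[OF this b(1)] show ?thesis
    by (simp add: mob_left_end assms)
qed

lemma filterlim_neg_powr_at_top:
  fixes f :: "'a \<Rightarrow> real"
  assumes "(f \<longlongrightarrow> 0) G" "eventually (\<lambda>x. f x > 0) G" "r < 0"
  shows "LIM x G. f x powr r :> at_top"
proof -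
  have "LIM x G. inverse (f x powr - r) :> at_top"
  proof (rule filterlim_inverse_at_top)
    show "((\<lambda>x. f x powr - r) \<longlongrightarrow> 0) G"
      using assms by (intro tendsto_zero_powrI[where b = "- r"]) (auto elim: eventually_mono)
    show "eventually (\<lambda>x. 0 < f x powr - r) G"
      using assms(2) by (rule eventually_mono) simp
  qed
  then show ?thesis by (simp add: powr_minus)
qed

text \<open>The power in the derivative has the negative exponent \<open>\<xi> - 1\<close>, and its
  base tends to zero from above. This blow-up keeps the solution off the endpoint for every input
  with nonzero \<open>mh\<close>.\<close>

lemma mob1_at_top:
  assumes "admissible F" "exponent F \<noteq> 1"
  shows "LIM x at_right (left_end F). mob1 F x :> at_top"
proof (cases F)
  case F: (Two_Sided \<alpha> \<beta> \<xi>)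
  have ev: "eventually (\<lambda>x. x \<in> {\<alpha><..<\<beta>}) (at_right \<alpha>)"
    using assms F by (intro eventually_at_right_real) simp
  have "((\<lambda>x. (x - \<alpha>) * (\<beta> - x)) \<longlongrightarrow> (\<alpha> - \<alpha>) * (\<beta> - \<alpha>)) (at_right \<alpha>)"
    by (intro tendsto_intros)
  then have "LIM x at_right \<alpha>. ((x - \<alpha>) * (\<beta> - x)) powr (\<xi> - 1) :> at_top"
    using assms F by (intro filterlim_neg_powr_at_top eventually_mono[OF ev]) auto
  moreover have "((\<lambda>x. \<xi> * (\<alpha> + \<beta> - 2 * x)) \<longlongrightarrow> \<xi> * (\<alpha> + \<beta> - 2 * \<alpha>)) (at_right \<alpha>)"
    by (intro tendsto_intros)
  ultimately have "LIM x at_right \<alpha>. \<xi> * (\<alpha> + \<beta> - 2 * x) * ((x - \<alpha>) * (\<beta> - x)) powr (\<xi> - 1) :> at_top"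
    by (rule filterlim_tendsto_pos_mult_at_top[rotated 2]) (use assms F in auto)
  then show ?thesis using assms F by (simp add: mult_ac)
next
  case F: (One_Sided \<xi>)
  have "LIM x at_right (0::real). x powr (\<xi> - 1) :> at_top"
    using assms F by (intro filterlim_neg_powr_at_top)
      (auto simp: eventually_at_right_less tendsto_ident_at)
  then have "LIM x at_right 0. \<xi> * x powr (\<xi> - 1) :> at_top"
    using assms F by (intro filterlim_tendsto_pos_mult_at_top[OF tendsto_const]) auto
  then show ?thesis using assms F by simp
qed

section \<open>Reflection symmetry of the two-sided mobilities\<close>

lemma mob_reflect: "mob (Two_Sided \<alpha> \<beta> \<xi>) (\<alpha> + \<beta> - x) = mob (Two_Sided \<alpha> \<beta> \<xi>) x"
  by (simp add: mult.commute)

lemma mob1_reflect: "mob1 (Two_Sided \<alpha> \<beta> \<xi>) (\<alpha> + \<beta> - x) = - mob1 (Two_Sided \<alpha> \<beta> \<xi>) x"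
proof -
  have "(\<alpha> + \<beta> - x - \<alpha>) * (\<beta> - (\<alpha> + \<beta> - x)) = (x - \<alpha>) * (\<beta> - x)"
    "\<alpha> + \<beta> - 2 * (\<alpha> + \<beta> - x) = - (\<alpha> + \<beta> - 2 * x)"
    by (simp_all add: algebra_simps)
  then show ?thesis by (auto simp only: mob1.simps mult_minus_right split: if_split)
qed

section \<open>The scalar function and the minimiser\<close>

locale mobility_problem =
  fixes F :: mobility and D\<^sub>\<rho> \<zeta> :: real and D\<^sub>m mh :: "real ^ 'd"
  assumes D\<rho>_pos: "D\<^sub>\<rho> > 0" and Dm_pos: "\<And>j. D\<^sub>m $ j > 0" and zeta_pos: "\<zeta> > 0"
    and adm: "admissible F"
begin

abbreviation L :: "real \<Rightarrow> real \<Rightarrow> real" where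
  "L h \<equiv> scalar_fun F D\<^sub>\<rho> D\<^sub>m \<zeta> h mh"

abbreviation S :: "real set" where
  "S \<equiv> scalar_dom F D\<^sub>m \<zeta> mh"

abbreviation mom :: "real \<Rightarrow> real ^ 'd" where
  "mom \<equiv> momentum F D\<^sub>m \<zeta> mh"

section \<open>Explicit derivatives of the scalar function\<close>

definition w :: "'d \<Rightarrow> real" where
  "w j = (D\<^sub>m $ j * mh $ j)\<^sup>2"

definition u :: "'d \<Rightarrow> real \<Rightarrow> real" where
  "u j x = D\<^sub>m $ j * mob F x + \<zeta>"

text \<open>The input density does not occur, since it only shifts \<open>L h\<close> by a constant.
  One derivative thus serves an input and its reflection.\<close>

definition L1 :: "real \<Rightarrow> real" where
  "L1 x = D\<^sub>\<rho> - \<zeta> / 2 * (\<Sum>j\<in>UNIV. w j *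
     (mob2 F x / (u j x)^2 - 2 * D\<^sub>m $ j * (mob1 F x)^2 / (u j x)^3))"

definition L2 :: "real \<Rightarrow> real" where
  "L2 x = - (\<zeta> / 2 * (\<Sum>j\<in>UNIV. w j *
     (mob3 F x / (u j x)^2 - 6 * D\<^sub>m $ j * mob1 F x * mob2 F x / (u j x)^3
      + 6 * (D\<^sub>m $ j)^2 * (mob1 F x)^3 / (u j x)^4)))"

text \<open>An open set on which \<open>L\<close> is smooth and which contains the bounds as far as
  the mobility is smooth; for exponent 1 it reaches beyond the endpoints up to the first pole.
  Openness is what allows \<open>deriv (L h)\<close>, known to equal \<open>L1\<close> only here, to
  be differentiated again.\<close>

definition tame :: "real set" where
  "tame = {x \<in> regular F. \<forall>j. mh $ j \<noteq> 0 \<longrightarrow> u j x > 0}"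

lemma w_nonneg: "w j \<ge> 0"
  by (simp add: w_def)

lemma w_eq_0_iff: "w j = 0 \<longleftrightarrow> mh $ j = 0"
  using Dm_pos[of j] by (simp add: w_def)

lemma w_pos: "mh $ j \<noteq> 0 \<Longrightarrow> w j > 0"
  using w_nonneg[of j] w_eq_0_iff[of j] by linarith

lemma u_pos: "x \<in> bounds F \<Longrightarrow> u j x > 0"
  using mob_nonneg[of x F] Dm_pos[of j] zeta_pos by (simp add: u_def add_nonneg_pos)

lemma L_eq:
  assumes "x \<in> regular F"
  shows "L h x = D\<^sub>\<rho> * (x - h) - \<zeta> / 2 * (\<Sum>j\<in>UNIV. w j * (mob1 F x / (u j x)^2))"
proof -
  have "deriv (mob F) x = mob1 F x" using DERIV_mob[OF assms] by (rule DERIV_imp_deriv)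
  then show ?thesis
    by (simp add: scalar_fun_def w_def u_def power_divide sum_distrib_left mult_ac)
qed

lemma regular_bounds_subset_tame: "regular F \<inter> bounds F \<subseteq> tame"
  using u_pos by (auto simp: tame_def)

lemma rising_subset_tame: "rising F \<subseteq> tame"
  using rising_subset[OF adm] regular_bounds_subset_tame by blast

lemma open_tame: "open tame"
proof -
  have "continuous_on (regular F) (mob F)"
    using DERIV_mob DERIV_isCont by (blast intro: continuous_at_imp_continuous_on)
  moreover have "open {v. mh $ j \<noteq> 0 \<longrightarrow> D\<^sub>m $ j * v + \<zeta> > 0}" for j
    by (cases "mh $ j = 0") (auto intro!: open_Collect_less continuous_intros)
  then have "open (\<Inter>j. {v. mh $ j \<noteq> 0 \<longrightarrow> D\<^sub>m $ j * v + \<zeta> > 0})"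
    by (intro open_INT) auto
  ultimately have "open (regular F \<inter> mob F -` (\<Inter>j. {v. mh $ j \<noteq> 0 \<longrightarrow> D\<^sub>m $ j * v + \<zeta> > 0}))"
    by (intro continuous_open_preimage open_regular)
  then show ?thesis
    by (rule back_subst[of "open"]) (auto simp: tame_def u_def)
qed

lemma DERIV_u: "x \<in> regular F \<Longrightarrow> (u j has_real_derivative D\<^sub>m $ j * mob1 F x) (at x)"
  unfolding u_def[abs_def] using DERIV_mob by (auto intro!: derivative_eq_intros)

lemma DERIV_L:
  assumes x: "x \<in> tame"
  shows "(L h has_real_derivative L1 x) (at x)"
proof -
  have xr: "x \<in> regular F" using x by (simp add: tame_def)
  have summand: "((\<lambda>x. w j * (mob1 F x / (u j x)^2)) has_real_derivative
      w j * (mob2 F x / (u j x)^2 - 2 * D\<^sub>m $ j * (mob1 F x)^2 / (u j x)^3)) (at x)" for j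
  \<comment> \<open>An index with \<open>mh $ j = 0\<close> may have \<open>u j x = 0\<close>, as
    \<open>tame\<close> excludes only poles of contributing summands; its summand is zero because
    \<open>w j\<close> is.\<close>
  proof (cases "mh $ j = 0")
    case True
    then show ?thesis by (simp add: w_eq_0_iff[THEN iffD2])
  next
    case False
    then have nz: "u j x \<noteq> 0" using x by (force simp: tame_def)
    have "((\<lambda>x. mob1 F x / (u j x)^2) has_real_derivative
        mob2 F x / (u j x)^2 - 2 * D\<^sub>m $ j * (mob1 F x)^2 / (u j x)^3) (at x)"
      using nz by (auto intro!: derivative_eq_intros DERIV_mob1[OF xr] DERIV_u[OF xr])
        (simp add: field_simps power2_eq_square power3_eq_cube power4_eq_xxxx)
    then show ?thesis by (rule DERIV_cmult)
  qed
  have "((\<lambda>x. D\<^sub>\<rho> * (x - h) - \<zeta> / 2 * (\<Sum>j\<in>UNIV. w j * (mob1 F x / (u j x)^2)))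
      has_real_derivative L1 x) (at x)"
    unfolding L1_def
    by (intro DERIV_diff DERIV_cmult DERIV_sum summand) (auto intro!: derivative_eq_intros)
  then show ?thesis
    by (rule has_field_derivative_transform_within_open[OF _ open_regular xr]) (simp add: L_eq)
qed

lemma DERIV_L1:
  assumes x: "x \<in> tame"
  shows "(L1 has_real_derivative L2 x) (at x)"
proof -
  have xr: "x \<in> regular F" using x by (simp add: tame_def)
  have summand: "((\<lambda>x. w j * (mob2 F x / (u j x)^2 - 2 * D\<^sub>m $ j * (mob1 F x)^2 / (u j x)^3))
      has_real_derivative w j * (mob3 F x / (u j x)^2 - 6 * D\<^sub>m $ j * mob1 F x * mob2 F x / (u j x)^3
      + 6 * (D\<^sub>m $ j)^2 * (mob1 F x)^3 / (u j x)^4)) (at x)" for j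
  proof (cases "mh $ j = 0")
    case True
    then show ?thesis by (simp add: w_eq_0_iff[THEN iffD2])
  next
    case False
    then have nz: "u j x \<noteq> 0" using x by (force simp: tame_def)
    have a: "((\<lambda>x. mob2 F x / (u j x)^2) has_real_derivative
        mob3 F x / (u j x)^2 - 2 * D\<^sub>m $ j * mob1 F x * mob2 F x / (u j x)^3) (at x)"
      using nz by (auto intro!: derivative_eq_intros DERIV_mob2[OF xr] DERIV_u[OF xr])
        (simp add: field_simps power2_eq_square power3_eq_cube power4_eq_xxxx)
    have b: "((\<lambda>x. 2 * D\<^sub>m $ j * (mob1 F x)^2 / (u j x)^3) has_real_derivative
        4 * D\<^sub>m $ j * mob1 F x * mob2 F x / (u j x)^3 - 6 * (D\<^sub>m $ j)^2 * (mob1 F x)^3 / (u j x)^4) (at x)"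
      using nz by (auto intro!: derivative_eq_intros DERIV_mob1[OF xr] DERIV_u[OF xr])
        (simp add: field_simps eval_nat_numeral)
    show ?thesis using DERIV_cmult[OF DERIV_diff[OF a b], of "w j"] by (simp add: algebra_simps)
  qed
  have "((\<lambda>x. D\<^sub>\<rho> - \<zeta> / 2 * (\<Sum>j\<in>UNIV. w j *
     (mob2 F x / (u j x)^2 - 2 * D\<^sub>m $ j * (mob1 F x)^2 / (u j x)^3))) has_real_derivative 0 - - L2 x) (at x)"
    unfolding L2_def minus_minus
    by (intro DERIV_diff DERIV_cmult DERIV_sum summand DERIV_const)
  then show ?thesis by (simp add: L1_def[abs_def])
qed

lemma deriv_L: "x \<in> tame \<Longrightarrow> deriv (L h) x = L1 x"
  using DERIV_L by (rule DERIV_imp_deriv)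

lemma DERIV_deriv_L:
  assumes "x \<in> tame"
  shows "(deriv (L h) has_real_derivative L2 x) (at x)"
  using DERIV_L1[OF assms] open_tame assms
  by (rule has_field_derivative_transform_within_open) (simp add: deriv_L)

lemma L1_ge:
  assumes "x \<in> regular F \<inter> bounds F"
  shows "L1 x \<ge> D\<^sub>\<rho>"
proof -
  have "w j * (mob2 F x / (u j x)^2 - 2 * D\<^sub>m $ j * (mob1 F x)^2 / (u j x)^3) \<le> 0" for j
  proof -
    have "u j x > 0" using u_pos assms by blast
    then have "mob2 F x / (u j x)^2 \<le> 0" "2 * D\<^sub>m $ j * (mob1 F x)^2 / (u j x)^3 \<ge> 0"
      using mob2_nonpos[OF adm, of x] Dm_pos[of j] by (auto intro!: divide_nonpos_pos divide_nonneg_pos)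
    then show ?thesis using w_nonneg by (intro mult_nonneg_nonpos) auto
  qed
  then have "(\<Sum>j\<in>UNIV. w j * (mob2 F x / (u j x)^2 - 2 * D\<^sub>m $ j * (mob1 F x)^2 / (u j x)^3)) \<le> 0"
    by (intro sum_nonpos) auto
  then show ?thesis using zeta_pos by (simp add: L1_def mult_nonneg_nonpos)
qed

lemma L2_summand_pos:
  assumes "x \<in> rising F"
  shows "mob3 F x / (u j x)^2 - 6 * D\<^sub>m $ j * mob1 F x * mob2 F x / (u j x)^3
      + 6 * (D\<^sub>m $ j)^2 * (mob1 F x)^3 / (u j x)^4 > 0"
proof -
  have x: "x \<in> regular F" "x \<in> bounds F" using rising_subset[OF adm] assms by auto
  note pos = u_pos[OF x(2), of j] mob1_pos[OF adm assms] Dm_pos[of j]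
  have "mob3 F x / (u j x)^2 \<ge> 0" using mob3_nonneg[OF adm x(1)] pos by simp
  moreover have "6 * D\<^sub>m $ j * mob1 F x * mob2 F x / (u j x)^3 \<le> 0"
    using mob2_nonpos[OF adm, of x] pos by (intro divide_nonpos_pos mult_nonneg_nonpos) auto
  moreover have "6 * (D\<^sub>m $ j)^2 * (mob1 F x)^3 / (u j x)^4 > 0" using pos by simp
  ultimately show ?thesis by linarith
qed

lemma L2_nonpos: "x \<in> rising F \<Longrightarrow> L2 x \<le> 0"
  unfolding L2_def using L2_summand_pos w_nonneg zeta_pos
  by (simp add: sum_nonneg less_imp_le)

text \<open>One nonzero component of \<open>mh\<close> suffices: the term with the cube of
  \<open>mob1\<close> is strictly positive in its bracket, and no other summand has the opposite
  sign.\<close>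

lemma L2_neg:
  assumes "x \<in> rising F" "mh \<noteq> 0"
  shows "L2 x < 0"
proof -
  obtain i where "mh $ i \<noteq> 0" using assms(2) by (auto simp: vec_eq_iff)
  then have "(\<Sum>j\<in>UNIV. w j * (mob3 F x / (u j x)^2 - 6 * D\<^sub>m $ j * mob1 F x * mob2 F x / (u j x)^3
      + 6 * (D\<^sub>m $ j)^2 * (mob1 F x)^3 / (u j x)^4)) > 0"
    using L2_summand_pos[OF assms(1)] w_nonneg
    by (intro sum_pos2[of _ i] mult_pos_pos w_pos) (auto simp: less_imp_le)
  then show ?thesis unfolding L2_def using zeta_pos by simp
qed

lemma second_deriv_neg_L:
  assumes "mh \<noteq> 0" "I \<subseteq> rising F"
  shows "second_deriv_neg (L h) I"
  unfolding second_deriv_neg_def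
proof
  fix x assume "x \<in> I"
  then have x: "x \<in> rising F" "x \<in> tame" using assms(2) rising_subset_tame by auto
  show "L h differentiable at x \<and> deriv (L h) differentiable at x \<and> deriv (deriv (L h)) x < 0"
    using DERIV_L[OF x(2), of h] DERIV_deriv_L[OF x(2), of h] L2_neg[OF x(1) assms(1)]
      DERIV_imp_deriv[OF DERIV_deriv_L[OF x(2), of h]]
    by (auto simp: real_differentiable_def)
qed

text \<open>The quantitative form matters for one-sided mobilities, whose bounds have no right end:
  it forces \<open>L\<close> to become nonnegative somewhere.\<close>

lemma L_growth:
  assumes "x \<in> regular F \<inter> bounds F" "y \<in> regular F \<inter> bounds F" "x < y"
  shows "L h y \<ge> L h x + D\<^sub>\<rho> * (y - x)"
proof -
  have z: "z \<in> regular F \<inter> bounds F" if "x \<le> z" "z \<le> y" for z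
    using regular_bounds_between[OF assms(1,2) that] .
  then obtain z where z': "x < z" "z < y" "L h y - L h x = (y - x) * L1 z"
    using MVT2[OF assms(3), of "L h" L1] DERIV_L regular_bounds_subset_tame by blast
  have "L1 z \<ge> D\<^sub>\<rho>" using z[of z] z' L1_ge by auto
  then have "(y - x) * L1 z \<ge> (y - x) * D\<^sub>\<rho>" using assms(3) by (intro mult_left_mono) auto
  then show ?thesis using z'(3) by (simp add: mult.commute)
qed

lemma L_strict_mono:
  assumes "x \<in> regular F \<inter> bounds F" "y \<in> regular F \<inter> bounds F" "x < y"
  shows "L h x < L h y"
  using L_growth[OF assms, of h] assms(3) D\<rho>_pos by (smt (verit) mult_pos_pos)

text \<open>The point where \<open>L\<close> changes sign; it may be an endpoint at which \<open>L\<close> does not vanish.\<close>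

definition stationary :: "real \<Rightarrow> real \<Rightarrow> bool" where
  "stationary h r \<longleftrightarrow> r \<in> bounds F \<and> (r \<in> open_bounds F \<longrightarrow> L h r = 0)
     \<and> (\<forall>x\<in>open_bounds F. (x < r \<longrightarrow> L h x < 0) \<and> (r < x \<longrightarrow> L h x > 0))"

lemma open_bounds_regular: "x \<in> open_bounds F \<Longrightarrow> x \<in> regular F \<inter> bounds F"
  using open_bounds_subset_regular open_bounds_subset_bounds by blast

text \<open>Without an interior root \<open>L\<close> keeps one sign by the intermediate value
  theorem. A positive sign puts the change at the left end, a negative one at \<beta>; for one-sided
  mobilities a negative sign contradicts the linear growth.\<close>

lemma stationary_exists: "\<exists>r. stationary h r"
proof (cases "\<exists>r\<in>open_bounds F. L h r = 0")
  case True
  then obtain r where r: "r \<in> open_bounds F" "L h r = 0" by blast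
  have "stationary h r"
    unfolding stationary_def
  proof (intro conjI impI ballI)
    show "r \<in> bounds F" using open_bounds_regular[OF r(1)] by simp
    fix x assume "x \<in> open_bounds F"
    note mono = L_strict_mono[of _ _ h, OF open_bounds_regular open_bounds_regular]
    show "L h x < 0" if "x < r" using mono[OF \<open>x \<in> open_bounds F\<close> r(1) that] r(2) by simp
    show "L h x > 0" if "r < x" using mono[OF r(1) \<open>x \<in> open_bounds F\<close> that] r(2) by simp
  qed (use r in simp)
  then show ?thesis ..
next
  case no_root: False
  have const: "L h y < 0" if x: "x \<in> open_bounds F" "L h x < 0" and y: "y \<in> open_bounds F" for x y
  proof (rule ccontr)
    assume "\<not> L h y < 0"
    then have pos: "L h y > 0" using no_root y by force
    have "x < y"
      using L_strict_mono[OF open_bounds_regular[OF y] open_bounds_regular[OF x(1)], of h] x(2) pos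
      by (cases x y rule: linorder_cases) auto
    have between: "z \<in> regular F \<inter> bounds F" if "x \<le> z" "z \<le> y" for z
      using regular_bounds_between[OF open_bounds_regular[OF x(1)] open_bounds_regular[OF y] that] .
    then have "\<forall>z. x \<le> z \<and> z \<le> y \<longrightarrow> isCont (L h) z"
      using DERIV_L DERIV_isCont regular_bounds_subset_tame by blast
    then obtain z where z: "x \<le> z" "z \<le> y" "L h z = 0"
      using IVT[of "L h" x 0 y] x(2) pos \<open>x < y\<close> by auto
    have "z \<noteq> x" "z \<noteq> y" using z(3) x(2) pos by auto
    then have "z \<in> open_bounds F"
      using open_bounds_between[of x F y z] open_bounds_regular[OF x(1)] open_bounds_regular[OF y] z by auto
    then show False using no_root z(3) by blast
  qed
  show ?thesis
  proof (cases "\<exists>x\<in>open_bounds F. L h x < 0")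
    case False
    then have "stationary h (left_end F)"
      using no_root left_end_in_bounds[OF adm] left_end_less[of _ F]
      unfolding stationary_def by (metis less_irrefl less_asym linorder_neqE_linordered_idom)
    then show ?thesis ..
  next
    case True
    then obtain x where x: "x \<in> open_bounds F" "L h x < 0" by blast
    show ?thesis
    proof (cases F)
      case (Two_Sided \<alpha> \<beta> \<xi>)
      then have "stationary h \<beta>"
        using const[OF x] adm unfolding stationary_def by auto
      then show ?thesis ..
    next
      case (One_Sided \<xi>)
      \<comment> \<open>At this \<open>y\<close> the linear lower bound for \<open>L\<close>,
        started from \<open>x\<close>, has just reached zero.\<close>
      define y where "y = x - L h x / D\<^sub>\<rho>"
      have "x < y" using x(2) D\<rho>_pos by (simp add: y_def divide_neg_pos)
      then have y: "y \<in> open_bounds F" using x(1) One_Sided by auto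
      have "L h x + D\<^sub>\<rho> * (y - x) \<le> L h y"
        using L_growth[OF open_bounds_regular[OF x(1)] open_bounds_regular[OF y] \<open>x < y\<close>] .
      moreover have "D\<^sub>\<rho> * (y - x) = - L h x" using D\<rho>_pos by (simp add: y_def)
      ultimately show ?thesis using const[OF x y] by linarith
    qed
  qed
qed

lemma stationary_less:
  assumes "stationary h r" "x \<in> open_bounds F" "L h x < 0"
  shows "x < r"
  using assms unfolding stationary_def by (metis less_asym less_irrefl linorder_neqE_linordered_idom)

lemma stationary_greater:
  assumes "stationary h r" "x \<in> open_bounds F" "L h x > 0"
  shows "r < x"
  using assms unfolding stationary_def by (metis less_asym less_irrefl linorder_neqE_linordered_idom)

lemma stationary_root:
  assumes r: "stationary h r" and x: "x \<in> regular F \<inter> bounds F" "L h x = 0"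
  shows "r = x"
proof (rule ccontr)
  assume "r \<noteq> x"
  \<comment> \<open>Both \<open>r\<close> and \<open>x\<close> may be endpoints, where
    \<open>stationary\<close> prescribes no sign. The midpoint is interior, so there the prescribed
    sign of \<open>L\<close> clashes with strict monotonicity from the root
    \<open>x\<close>.\<close>
  define z where "z = (r + x) / 2"
  have rb: "r \<in> bounds F" using r by (simp add: stationary_def)
  consider "r < x" | "x < r" using \<open>r \<noteq> x\<close> by linarith
  then show False
  proof cases
    case 1
    then have z: "r < z" "z < x" by (auto simp: z_def)
    then have "z \<in> open_bounds F" using open_bounds_between[of r F x z] rb x by auto
    then show False
      using L_strict_mono[OF open_bounds_regular x(1) z(2), of h] r z x(2)
      unfolding stationary_def by force
  next
    case 2
    then have z: "x < z" "z < r" by (auto simp: z_def)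
    then have "z \<in> open_bounds F" using open_bounds_between[of x F r z] rb x by auto
    then show False
      using L_strict_mono[OF x(1) open_bounds_regular z(1), of h] r z x(2)
      unfolding stationary_def by force
  qed
qed

section \<open>Domain and roots of the scalar function\<close>

lemma scalar_dom_subset: "S \<subseteq> regular F"
proof
  fix x assume x: "x \<in> S"
  show "x \<in> regular F"
  proof (cases "exponent F = 1")
    case True
    then show ?thesis by (cases F) auto
  next
    case False
    then show ?thesis
      using x mob_pos_iff[OF adm] open_bounds_regular by (auto simp: scalar_dom_def)
  qed
qed

lemma regular_bounds_subset_scalar_dom: "regular F \<inter> bounds F \<subseteq> S"
proof
  fix x assume x: "x \<in> regular F \<inter> bounds F"
  show "x \<in> S"
  proof (cases "exponent F = 1")
    case True
    moreover have "u j x \<noteq> 0" for j using u_pos[of x j] x by simp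
    ultimately show ?thesis by (simp add: scalar_dom_def u_def)
  next
    case False
    then have "x \<in> open_bounds F" using x by (cases F) auto
    then show ?thesis using mob_pos_iff[OF adm] x by (auto simp: scalar_dom_def)
  qed
qed

lemma stationary_roots:
  assumes "stationary h r" "r \<in> open_bounds F"
  shows "{x \<in> S. L h x = 0} \<inter> bounds F = {r}"
proof -
  have "L h r = 0" "r \<in> regular F \<inter> bounds F"
    using assms open_bounds_regular by (auto simp: stationary_def)
  moreover have "r = x" if "x \<in> S" "L h x = 0" "x \<in> bounds F" for x
    using stationary_root[OF assms(1)] that scalar_dom_subset by blast
  ultimately show ?thesis using regular_bounds_subset_scalar_dom by blast
qed

text \<open>The minimum of the objective over the momentum.\<close>

definition reduced :: "real \<Rightarrow> real \<Rightarrow> real" where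
  "reduced h x = 1/2 * D\<^sub>\<rho> * (x - h)\<^sup>2 + (\<Sum>j\<in>UNIV. 1/2 * \<zeta> * D\<^sub>m $ j * (mh $ j)\<^sup>2 / u j x)"

lemma DERIV_reduced:
  assumes x: "x \<in> regular F \<inter> bounds F"
  shows "(reduced h has_real_derivative L h x) (at x)"
proof -
  have "((\<lambda>x. 1/2 * \<zeta> * D\<^sub>m $ j * (mh $ j)\<^sup>2 / u j x) has_real_derivative
      - (\<zeta> / 2 * (w j * (mob1 F x / (u j x)^2)))) (at x)" for j
    using u_pos[of x j] x
    by (auto intro!: derivative_eq_intros DERIV_u simp: w_def)
      (simp add: field_simps power2_eq_square)
  then have "((\<lambda>x. 1/2 * D\<^sub>\<rho> * (x - h)\<^sup>2 + (\<Sum>j\<in>UNIV. 1/2 * \<zeta> * D\<^sub>m $ j * (mh $ j)\<^sup>2 / u j x))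
      has_real_derivative D\<^sub>\<rho> * (x - h) + (\<Sum>j\<in>UNIV. - (\<zeta> / 2 * (w j * (mob1 F x / (u j x)^2))))) (at x)"
    by (intro DERIV_add DERIV_sum) (auto intro!: derivative_eq_intros)
  then show ?thesis
    using x by (simp add: reduced_def[abs_def] L_eq sum_negf sum_distrib_left)
qed

lemma continuous_on_reduced: "continuous_on (bounds F) (reduced h)"
proof -
  have "u j x \<noteq> 0" if "x \<in> bounds F" for j x using u_pos[OF that, of j] by simp
  then show ?thesis
    unfolding reduced_def[abs_def] u_def[abs_def]
    by (intro continuous_intros continuous_on_mob[OF adm]) auto
qed

text \<open>The derivative of \<open>reduced h\<close> is \<open>L h\<close>, negative before
  \<open>r\<close> and positive after it. Only interior derivatives are used, together with
  continuity up to the ends, because the slope may be infinite at an endpoint.\<close>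

lemma reduced_less:
  assumes r: "stationary h r" and x: "x \<in> bounds F" "x \<noteq> r"
  shows "reduced h r < reduced h x"
proof -
  have rb: "r \<in> bounds F" using r by (simp add: stationary_def)
  have conv: "{a..b} \<subseteq> bounds F" if "a \<in> bounds F" "b \<in> bounds F" for a b
    using that by (cases F) auto
  note cont = continuous_on_subset[OF continuous_on_reduced conv]
  consider "x < r" | "r < x" using x(2) by linarith
  then show ?thesis
  proof cases
    case 1
    then show ?thesis
    proof (rule DERIV_neg_imp_decreasing_open)
      fix z assume "x < z" "z < r"
      then have "z \<in> open_bounds F" using open_bounds_between x(1) rb by blast
      then show "\<exists>y. (reduced h has_real_derivative y) (at z) \<and> y < 0"
        using DERIV_reduced open_bounds_regular r \<open>z < r\<close> unfolding stationary_def by blast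
    qed (intro cont x rb)
  next
    case 2
    then show ?thesis
    proof (rule DERIV_pos_imp_increasing_open)
      fix z assume "r < z" "z < x"
      then have "z \<in> open_bounds F" using open_bounds_between x(1) rb by blast
      then show "\<exists>y. (reduced h has_real_derivative y) (at z) \<and> 0 < y"
        using DERIV_reduced open_bounds_regular r \<open>r < z\<close> unfolding stationary_def by blast
    qed (intro cont x rb)
  qed
qed

text \<open>This completes the square in each component: the vertex is \<open>mom x\<close>, the
  curvature is \<open>D\<^sub>m $ j + \<zeta> / mob F x\<close>, and the constant left over is a
  summand of \<open>reduced\<close>. At zero mobility \<open>u j x = \<zeta>\<close>, so
  \<open>reduced\<close> is also the cost of zero momentum there.\<close>

lemma objective_eq:
  "objective F D\<^sub>\<rho> D\<^sub>m \<zeta> h mh (x, m) =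
     (if x \<in> bounds F \<and> mob F x > 0 then
        ereal (reduced h x + (\<Sum>j\<in>UNIV. 1/2 * (D\<^sub>m $ j + \<zeta> / mob F x) * (m $ j - mom x $ j)\<^sup>2))
      else if x \<in> bounds F \<and> mob F x = 0 \<and> m = 0 then ereal (reduced h x) else \<infinity>)"
proof -
  consider (pos) "x \<in> bounds F" "mob F x > 0" | (zero) "x \<in> bounds F" "mob F x = 0" "m = 0"
    | (out) "\<not> (x \<in> bounds F \<and> mob F x > 0)" "\<not> (x \<in> bounds F \<and> mob F x = 0 \<and> m = 0)"
    by blast
  then show ?thesis
  proof cases
    case pos
    have norm: "(norm m)\<^sup>2 = (\<Sum>j\<in>UNIV. (m $ j)\<^sup>2)"
      unfolding power2_norm_eq_inner inner_vec_def by (simp add: power2_eq_square)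
    have sq: "1/2 * (D\<^sub>m $ j * (m $ j - mh $ j)\<^sup>2) + \<zeta> / 2 * ((m $ j)\<^sup>2 / mob F x)
        = 1/2 * \<zeta> * D\<^sub>m $ j * (mh $ j)\<^sup>2 / u j x
          + 1/2 * (D\<^sub>m $ j + \<zeta> / mob F x) * (m $ j - mom x $ j)\<^sup>2" for j
    proof -
      define M where "M = mob F x"
      define U where "U = D\<^sub>m $ j * M + \<zeta>"
      have nz: "M \<noteq> 0" "U \<noteq> 0"
        using pos u_pos[OF pos(1), of j] by (auto simp: M_def U_def u_def)
      have mom: "mom x $ j = M * D\<^sub>m $ j * mh $ j / U"
        by (simp add: momentum_def M_def U_def)
      \<comment> \<open>With \<open>\<zeta>\<close> expressed through \<open>U\<close> and
        \<open>M\<close>, the claim becomes a polynomial identity after clearing the two nonzero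
        denominators.\<close>
      have z: "\<zeta> = U - D\<^sub>m $ j * M" by (simp add: U_def)
      have "1/2 * (D\<^sub>m $ j * (m $ j - mh $ j)\<^sup>2) + \<zeta> / 2 * ((m $ j)\<^sup>2 / M)
        = 1/2 * \<zeta> * D\<^sub>m $ j * (mh $ j)\<^sup>2 / U
          + 1/2 * (D\<^sub>m $ j + \<zeta> / M) * (m $ j - M * D\<^sub>m $ j * mh $ j / U)\<^sup>2"
        unfolding z using nz by (simp add: field_simps power2_eq_square)
      then show ?thesis using mom by (simp add: M_def U_def u_def)
    qed
    have "1/2 * (\<Sum>j\<in>UNIV. D\<^sub>m $ j * (m $ j - mh $ j)\<^sup>2) + \<zeta> / 2 * ((norm m)\<^sup>2 / mob F x)
        = (\<Sum>j\<in>UNIV. 1/2 * (D\<^sub>m $ j * (m $ j - mh $ j)\<^sup>2) + \<zeta> / 2 * ((m $ j)\<^sup>2 / mob F x))"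
      by (simp add: norm sum.distrib sum_distrib_left sum_divide_distrib)
    also have "\<dots> = (\<Sum>j\<in>UNIV. 1/2 * \<zeta> * D\<^sub>m $ j * (mh $ j)\<^sup>2 / u j x)
        + (\<Sum>j\<in>UNIV. 1/2 * (D\<^sub>m $ j + \<zeta> / mob F x) * (m $ j - mom x $ j)\<^sup>2)"
      unfolding sq by (rule sum.distrib)
    finally show ?thesis
      using pos by (simp add: objective_def action_def reduced_def)
  next
    case zero
    have "1/2 * (\<Sum>j\<in>UNIV. D\<^sub>m $ j * (0 - mh $ j)\<^sup>2) = (\<Sum>j\<in>UNIV. 1/2 * \<zeta> * D\<^sub>m $ j * (mh $ j)\<^sup>2 / u j x)"
      using zero zeta_pos by (simp add: u_def sum_distrib_left)
    then show ?thesis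
      using zero by (simp add: objective_def action_def reduced_def)
  next
    case out
    then show ?thesis
      using zeta_pos by (simp only: objective_def action_def if_False prod.case) simp
  qed
qed

lemma objective_ge_reduced:
  assumes "x \<in> bounds F"
  shows "objective F D\<^sub>\<rho> D\<^sub>m \<zeta> h mh (x, m) \<ge> ereal (reduced h x)"
  using Dm_pos zeta_pos unfolding objective_eq
  by (auto intro!: sum_nonneg mult_nonneg_nonneg add_nonneg_nonneg simp: less_imp_le)

lemma objective_gt_reduced:
  assumes "x \<in> bounds F" "m \<noteq> mom x"
  shows "objective F D\<^sub>\<rho> D\<^sub>m \<zeta> h mh (x, m) > ereal (reduced h x)"
proof (cases "mob F x > 0")
  case True
  obtain i where "m $ i \<noteq> mom x $ i" using assms(2) by (auto simp: vec_eq_iff)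
  moreover have "D\<^sub>m $ j + \<zeta> / mob F x > 0" for j
    using Dm_pos[of j] zeta_pos True by (simp add: add_pos_pos)
  ultimately have "(\<Sum>j\<in>UNIV. 1/2 * (D\<^sub>m $ j + \<zeta> / mob F x) * (m $ j - mom x $ j)\<^sup>2) > 0"
    by (intro sum_pos2[of _ i]) (auto simp: less_imp_le)
  then show ?thesis using assms(1) True by (simp add: objective_eq)
next
  case False
  then have "mob F x = 0" using mob_nonneg[OF assms(1)] by simp
  then have "mom x = 0" by (simp add: momentum_def vec_eq_iff)
  then show ?thesis using assms False by (simp add: objective_eq)
qed

lemma objective_mom:
  assumes "x \<in> bounds F"
  shows "objective F D\<^sub>\<rho> D\<^sub>m \<zeta> h mh (x, mom x) = ereal (reduced h x)"
proof (cases "mob F x > 0")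
  case False
  then have "mob F x = 0" using mob_nonneg[OF assms(1)] by simp
  then have "mom x = 0" by (simp add: momentum_def vec_eq_iff)
  then show ?thesis using assms \<open>mob F x = 0\<close> by (simp add: objective_eq)
qed (use assms in \<open>simp add: objective_eq\<close>)

text \<open>Any other point loses strictly in one of three ways: infinite cost outside the bounds, a
  different density, or the density \<open>r\<close> with a different momentum.\<close>

lemma is_arg_min_iff:
  assumes r: "stationary h r"
  shows "is_arg_min (objective F D\<^sub>\<rho> D\<^sub>m \<zeta> h mh) (\<lambda>_. True) p \<longleftrightarrow> p = (r, mom r)"
proof -
  have rb: "r \<in> bounds F" using r by (simp add: stationary_def)
  have less: "objective F D\<^sub>\<rho> D\<^sub>m \<zeta> h mh (r, mom r) < objective F D\<^sub>\<rho> D\<^sub>m \<zeta> h mh q"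
    if neq: "q \<noteq> (r, mom r)" for q
  proof (cases q)
    case q: (Pair x m)
    consider "x \<notin> bounds F" | "x \<in> bounds F" "x \<noteq> r" | "x = r" "m \<noteq> mom r" using neq q by blast
    then show ?thesis
    proof cases
      case 1
      then show ?thesis unfolding objective_mom[OF rb] q by (simp add: objective_eq)
    next
      case 2
      then have "ereal (reduced h r) < ereal (reduced h x)" using reduced_less[OF r] by simp
      also have "\<dots> \<le> objective F D\<^sub>\<rho> D\<^sub>m \<zeta> h mh q" unfolding q by (rule objective_ge_reduced[OF 2(1)])
      finally show ?thesis unfolding objective_mom[OF rb] .
    next
      case 3
      then show ?thesis unfolding objective_mom[OF rb] q using objective_gt_reduced[OF rb] by simp
    qed
  qed
  then show ?thesis unfolding is_arg_min_def by (metis less_asym less_irrefl)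
qed

subsection \<open>Location of the minimiser and convergence of Newton's method\<close>

lemma summand_nonneg: "x \<in> rising F \<Longrightarrow> w j * (mob1 F x / (u j x)\<^sup>2) \<ge> 0"
  using w_nonneg[of j] mob1_pos[OF adm, of x] by simp

lemma L_mh_0: "mh = 0 \<Longrightarrow> L h x = D\<^sub>\<rho> * (x - h)"
  by (simp add: scalar_fun_def)

text \<open>A single summand with \<open>mh $ i \<noteq> 0\<close> outweighs the linear term close
  to the endpoint: its denominator stays bounded while \<open>mob1\<close> tends to
  infinity.\<close>

lemma eventually_L_neg_singular:
  assumes "exponent F \<noteq> 1" "mh \<noteq> 0"
  shows "eventually (\<lambda>x. L h x < 0) (at_right (left_end F))"
proof -
  obtain i where i: "mh $ i \<noteq> 0" using assms(2) by (auto simp: vec_eq_iff)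
  \<comment> \<open>Where \<open>mob F x < 1\<close>, \<open>u i x\<close> is at most
    \<open>D\<^sub>m $ i + \<zeta>\<close>, so \<open>K * mob1 F x\<close> bounds the summand from
    below. The threshold for \<open>mob1\<close> comes from bounding the linear term by
    \<open>x < left_end F + 1\<close>.\<close>
  define K where "K = w i / (D\<^sub>m $ i + \<zeta>)\<^sup>2"
  have "K > 0" using w_pos[OF i] Dm_pos[of i] zeta_pos by (simp add: K_def)
  have "eventually (\<lambda>x. mob F x < 1) (at_right (left_end F))"
    using tendsto_mob_left_end[OF adm] by (rule order_tendstoD) simp
  moreover have "eventually (\<lambda>x. x \<in> {left_end F<..<left_end F + 1}) (at_right (left_end F))"
    by (rule eventually_at_right_real) simp
  moreover have "eventually (\<lambda>x. mob1 F x > 2 * D\<^sub>\<rho> * (left_end F + 1 - h) / (\<zeta> * K)) (at_right (left_end F))"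
    using mob1_at_top[OF adm assms(1)] by (simp add: filterlim_at_top_dense)
  ultimately show ?thesis using eventually_at_right_left_end[OF adm]
  proof eventually_elim
    case (elim x)
    then have x: "x \<in> rising F" "x \<in> regular F" "x \<in> bounds F" using open_bounds_regular by auto
    have "u i x \<le> D\<^sub>m $ i + \<zeta>" using elim(1) Dm_pos[of i] by (simp add: u_def)
    then have "(u i x)\<^sup>2 \<le> (D\<^sub>m $ i + \<zeta>)\<^sup>2" using u_pos[OF x(3), of i] by (intro power_mono) auto
    then have "K * mob1 F x \<le> w i * (mob1 F x / (u i x)\<^sup>2)"
      using mob1_pos[OF adm x(1)] w_nonneg[of i] u_pos[OF x(3), of i]
      by (auto simp: K_def intro!: divide_left_mono mult_pos_pos)
    also have "\<dots> \<le> (\<Sum>j\<in>UNIV. w j * (mob1 F x / (u j x)\<^sup>2))"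
      by (rule member_le_sum) (use summand_nonneg[OF x(1)] in auto)
    finally have "\<zeta> / 2 * (K * mob1 F x) \<le> \<zeta> / 2 * (\<Sum>j\<in>UNIV. w j * (mob1 F x / (u j x)\<^sup>2))"
      using zeta_pos by (intro mult_left_mono) auto
    moreover have "D\<^sub>\<rho> * (left_end F + 1 - h) < \<zeta> / 2 * (K * mob1 F x)"
      using elim(3) \<open>K > 0\<close> zeta_pos by (simp add: field_simps)
    moreover have "D\<^sub>\<rho> * (x - h) \<le> D\<^sub>\<rho> * (left_end F + 1 - h)"
      using elim(2) D\<rho>_pos by (intro mult_left_mono) auto
    ultimately show ?case unfolding L_eq[OF x(2)] by linarith
  qed
qed

lemma left_end_regular: "exponent F = 1 \<Longrightarrow> left_end F \<in> regular F \<inter> bounds F"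
  using adm by (cases F) auto

lemma eventually_L_neg_smooth:
  assumes "exponent F = 1" "L h (left_end F) < 0"
  shows "eventually (\<lambda>x. L h x < 0) (at_right (left_end F))"
proof -
  have "isCont (L h) (left_end F)"
    using left_end_regular[OF assms(1)] regular_bounds_subset_tame DERIV_L DERIV_isCont by blast
  then have "(L h \<longlongrightarrow> L h (left_end F)) (at_right (left_end F))"
    unfolding isCont_def by (rule tendsto_mono[OF at_le, rotated]) simp
  then show ?thesis using assms(2) by (rule order_tendstoD)
qed

lemma eventually_L_neg_mh_0:
  assumes "mh = 0" "left_end F < h"
  shows "eventually (\<lambda>x. L h x < 0) (at_right (left_end F))"
  using eventually_at_right_real[OF assms(2)]
  by (rule eventually_mono) (use D\<rho>_pos in \<open>simp add: L_mh_0[OF assms(1)] mult_pos_neg\<close>)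

lemma left_end_less_stationary:
  assumes "stationary h r" "eventually (\<lambda>x. L h x < 0) (at_right (left_end F))"
  shows "left_end F < r"
proof -
  obtain x where x: "x \<in> open_bounds F" "L h x < 0"
    using eventually_happens'[OF trivial_limit_at_right_real
        eventually_conj[OF assms(2) eventually_at_right_left_end[OF adm]]] by auto
  then show ?thesis using stationary_less[OF assms(1) x] left_end_less[OF x(1)] by linarith
qed

lemma stationary_eq_left_end:
  assumes "stationary h r" "exponent F = 1" "L h (left_end F) \<ge> 0"
  shows "r = left_end F"
proof (rule ccontr)
  assume "r \<noteq> left_end F"
  have rb: "r \<in> bounds F" using assms(1) by (simp add: stationary_def)
  define z where "z = (left_end F + r) / 2"
  have z: "left_end F < z" "z < r"
    using left_end_le[OF rb] \<open>r \<noteq> left_end F\<close> by (auto simp: z_def)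
  then have zo: "z \<in> open_bounds F"
    using open_bounds_between[OF left_end_in_bounds[OF adm] rb] by blast
  then have "L h z < 0" using assms(1) z(2) by (auto simp: stationary_def)
  moreover have "L h (left_end F) < L h z"
    using L_strict_mono[OF left_end_regular[OF assms(2)] open_bounds_regular[OF zo] z(1)] .
  ultimately show False using assms(3) by linarith
qed

text \<open>The mobility vanishes at the endpoint, so every \<open>u j\<close> equals
  \<open>\<zeta>\<close> and the sum collapses. As a function of the input, this value changes sign
  at \<open>C\<^sub>1\<close> for slope 1 and at
  \<open>\<alpha> - C\<^sub>2 \<alpha> \<beta>\<close> for slope \<open>\<beta> - \<alpha>\<close>,
  which is the origin of both constants.\<close>

lemma L_left_end:
  assumes "exponent F = 1"
  shows "L h (left_end F) = D\<^sub>\<rho> * (left_end F - h) - mob1 F (left_end F) / (2 * \<zeta>) * (\<Sum>j\<in>UNIV. w j)"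
proof -
  have "\<zeta> / 2 * (\<Sum>j\<in>UNIV. w j * (mob1 F (left_end F) / \<zeta>\<^sup>2))
      = (\<Sum>j\<in>UNIV. mob1 F (left_end F) / (2 * \<zeta>) * w j)"
    unfolding sum_distrib_left
    by (rule sum.cong) (use zeta_pos in \<open>auto simp: field_simps power2_eq_square\<close>)
  then show ?thesis
    using left_end_regular[OF assms]
    by (simp add: L_eq u_def mob_left_end[OF adm] sum_distrib_left)
qed

section \<open>Exponent 1: roots beyond the left endpoint\<close>

lemma mob1_left_end_pos: "exponent F = 1 \<Longrightarrow> mob1 F (left_end F) > 0"
  using adm by (cases F) auto

lemma le_left_end:
  assumes "exponent F = 1" "L h (left_end F) \<ge> 0"
  shows "h \<le> left_end F"
proof -
  have "0 \<le> mob1 F (left_end F) / (2 * \<zeta>) * (\<Sum>j\<in>UNIV. w j)"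
    using mob1_left_end_pos[OF assms(1)] zeta_pos by (simp add: sum_nonneg w_nonneg)
  then have "0 \<le> D\<^sub>\<rho> * (left_end F - h)" using assms by (simp add: L_left_end)
  then show ?thesis using D\<rho>_pos by (simp add: zero_le_mult_iff)
qed

text \<open>Within the bounds \<open>L\<close> increases strictly from a nonnegative value. Right of
  \<beta> the slope \<open>mob1\<close> is nonpositive, so subtracting the sum cannot lower
  \<open>D\<^sub>\<rho> * (x - h) > 0\<close>; since \<open>u\<close> enters squared, this holds on
  either side of a pole.\<close>

lemma root_le_left_end:
  assumes "exponent F = 1" "L h (left_end F) \<ge> 0" "x \<in> S" "L h x = 0"
  shows "x \<le> left_end F"
proof (rule ccontr)
  assume "\<not> x \<le> left_end F"
  then have x: "left_end F < x" by simp
  have xr: "x \<in> regular F" using assms(3) scalar_dom_subset by blast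
  show False
  proof (cases "x \<in> bounds F")
    case True
    then show False
      using L_strict_mono[OF left_end_regular[OF assms(1)] _ x, of h] xr assms(2,4) by simp
  next
    case False
    then have "mob1 F x \<le> 0" using x assms(1) adm by (cases F) auto
    then have "(\<Sum>j\<in>UNIV. w j * (mob1 F x / (u j x)\<^sup>2)) \<le> 0"
      by (intro sum_nonpos mult_nonneg_nonpos w_nonneg divide_nonpos_nonneg) auto
    then have "\<zeta> / 2 * (\<Sum>j\<in>UNIV. w j * (mob1 F x / (u j x)\<^sup>2)) \<le> 0"
      using zeta_pos by (intro mult_nonneg_nonpos) auto
    moreover have "D\<^sub>\<rho> * (x - h) > 0" using x le_left_end[OF assms(1,2)] D\<rho>_pos by simp
    ultimately show False using assms(4) unfolding L_eq[OF xr] by linarith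
  qed
qed

lemma mob_mono_left:
  assumes "exponent F = 1" "x \<le> y" "y \<le> left_end F"
  shows "mob F x \<le> mob F y"
proof (cases F)
  case (Two_Sided \<alpha> \<beta> \<xi>)
  have "0 \<le> (y - x) * (\<alpha> + \<beta> - x - y)"
    using assms adm Two_Sided by (intro mult_nonneg_nonneg) auto
  then show ?thesis using assms Two_Sided by (simp add: algebra_simps)
qed (use assms in simp)

lemma mob1_left:
  assumes "exponent F = 1" "x \<le> left_end F"
  shows "mob1 F x \<ge> mob1 F (left_end F)"
  using assms adm by (cases F) auto

text \<open>This serves to give \<open>u i\<close> a prescribed value between 0 and
  \<open>\<zeta>\<close> at a point left of the endpoint.\<close>

lemma mob_onto_left:
  assumes "exponent F = 1" "v \<le> 0"
  shows "\<exists>x \<le> left_end F. mob F x = v"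
proof -
  obtain z where z: "z \<le> left_end F" "mob F z \<le> v"
  proof (cases F)
    case (Two_Sided \<alpha> \<beta> \<xi>)
    \<comment> \<open>For \<open>z \<le> \<alpha>\<close> the factor \<open>\<beta> - z\<close> is
      at least \<open>\<beta> - \<alpha>\<close>, while \<open>z - \<alpha>\<close> is nonpositive.
      This \<open>z\<close> makes the product with the smaller factor exactly \<open>v\<close>, an
      upper bound for the mobility.\<close>
    define z where "z = \<alpha> + v / (\<beta> - \<alpha>)"
    have "\<alpha> < \<beta>" using adm Two_Sided by simp
    then have "z \<le> \<alpha>" using assms(2) by (simp add: z_def divide_nonpos_pos)
    then have "(z - \<alpha>) * (\<beta> - z) \<le> (z - \<alpha>) * (\<beta> - \<alpha>)" by (intro mult_left_mono_neg) auto
    also have "\<dots> = v" using \<open>\<alpha> < \<beta>\<close> by (simp add: z_def)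
    finally show ?thesis using that[of z] \<open>z \<le> \<alpha>\<close> assms(1) Two_Sided by simp
  next
    case (One_Sided \<xi>)
    then show ?thesis using that[of v] assms by simp
  qed
  have "regular F = UNIV" using assms(1) by (cases F) auto
  then have "\<forall>x. z \<le> x \<and> x \<le> left_end F \<longrightarrow> isCont (mob F) x"
    using DERIV_mob DERIV_isCont by blast
  then obtain x where "z \<le> x" "x \<le> left_end F" "mob F x = v"
    using IVT[of "mob F" z v "left_end F"] z assms(2) mob_left_end[OF adm] by auto
  then show ?thesis by blast
qed

text \<open>Going left from the endpoint, the scalar function tends to minus infinity at the first pole;
  the pole belongs to the index with the largest weight among those that contribute.\<close>

lemma root_left_of_left_end:
  assumes "exponent F = 1" "L h (left_end F) \<ge> 0"
  shows "\<exists>x\<in>S. L h x = 0"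
proof (cases "mh = 0")
  case True
  have "h \<in> S" using assms(1) True by (simp add: scalar_dom_def)
  moreover have "L h h = 0" using L_mh_0[OF True] by simp
  ultimately show ?thesis by blast
next
  case False
  have reg: "regular F = UNIV" using assms(1) by (cases F) auto
  define J where "J = {j. mh $ j \<noteq> 0}"
  have "finite J" "J \<noteq> {}" using False by (auto simp: J_def vec_eq_iff)
  then obtain i where i: "i \<in> J" and i_max: "\<And>j. j \<in> J \<Longrightarrow> D\<^sub>m $ j \<le> D\<^sub>m $ i"
    using obtains_MAX[of J "\<lambda>j. D\<^sub>m $ j"] by (metis Max_ge finite_imageI imageI)
  have wi: "w i > 0" using i w_pos by (simp add: J_def)
  define k where "k = mob1 F (left_end F)"
  have k: "k > 0" using mob1_left_end_pos[OF assms(1)] by (simp add: k_def)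
  \<comment> \<open>Left of the endpoint \<open>L\<close> is negative once the square of
    \<open>1 / u i x\<close> exceeds \<open>A\<close>, for then the summand of \<open>i\<close>
    alone outweighs the linear term.\<close>
  define A where "A = 2 * D\<^sub>\<rho> * (left_end F - h) / (\<zeta> * w i * k)"
  have "A \<ge> 0"
    using le_left_end[OF assms] D\<rho>_pos zeta_pos wi k by (simp add: A_def)
  \<comment> \<open>This is the value that \<open>u i\<close> will attain. It satisfies
    \<open>1 / t \<ge> A + 1\<close>, whose square exceeds \<open>A\<close>, and
    \<open>1 / t \<ge> 1 / \<zeta>\<close>, so that the mobility required for it is
    nonpositive.\<close>
  define t where "t = 1 / (1 / \<zeta> + A + 1)"
  have t: "t > 0" "t \<le> \<zeta>" using \<open>A \<ge> 0\<close> zeta_pos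
    by (auto simp: t_def field_simps add_pos_nonneg)
  have "1 / t = 1 / \<zeta> + A + 1" by (simp add: t_def)
  then have "A + 1 \<le> 1 / t" using zeta_pos by simp
  then have "(A + 1)\<^sup>2 \<le> (1 / t)\<^sup>2" using \<open>A \<ge> 0\<close> by (intro power_mono) auto
  moreover have "A < (A + 1)\<^sup>2" using \<open>A \<ge> 0\<close> by (simp add: power2_sum add_nonneg_pos)
  ultimately have At: "A < (1 / t)\<^sup>2" by linarith
  have "(t - \<zeta>) / D\<^sub>m $ i \<le> 0" using t Dm_pos[of i] by (simp add: divide_nonpos_pos)
  then obtain x where x: "x \<le> left_end F" "mob F x = (t - \<zeta>) / D\<^sub>m $ i"
    using mob_onto_left[OF assms(1)] by blast
  have ux: "u i x = t" using x(2) Dm_pos[of i] by (simp add: u_def)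
  \<comment> \<open>A nonpositive mobility is scaled down most by the largest weight. Hence
    \<open>u j\<close> is at least \<open>t\<close> at \<open>x\<close> for every contributing
    \<open>j\<close>, and it does not decrease towards the endpoint.\<close>
  have tame: "y \<in> tame" if y: "x \<le> y" "y \<le> left_end F" for y
  proof -
    have "u j y > 0" if "mh $ j \<noteq> 0" for j
    proof -
      have "t - \<zeta> \<le> D\<^sub>m $ j * mob F x"
        using mult_right_mono_neg[OF i_max[of j] \<open>(t - \<zeta>) / D\<^sub>m $ i \<le> 0\<close>] that x(2) Dm_pos[of i]
        by (simp add: J_def)
      also have "\<dots> \<le> D\<^sub>m $ j * mob F y"
        using mob_mono_left[OF assms(1) y] Dm_pos[of j] by (intro mult_left_mono) auto
      finally show ?thesis using t by (simp add: u_def)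
    qed
    then show ?thesis by (simp add: tame_def reg)
  qed
  have m1: "mob1 F x \<ge> k" using mob1_left[OF assms(1) x(1)] by (simp add: k_def)
  have "w i * (k / t\<^sup>2) \<le> w i * (mob1 F x / (u i x)\<^sup>2)"
    using m1 wi t by (simp add: ux divide_right_mono)
  also have "\<dots> \<le> (\<Sum>j\<in>UNIV. w j * (mob1 F x / (u j x)\<^sup>2))"
    by (rule member_le_sum) (use m1 k w_nonneg in auto)
  finally have "\<zeta> / 2 * (w i * (k / t\<^sup>2)) \<le> \<zeta> / 2 * (\<Sum>j\<in>UNIV. w j * (mob1 F x / (u j x)\<^sup>2))"
    using zeta_pos by (intro mult_left_mono) auto
  moreover have "D\<^sub>\<rho> * (left_end F - h) < \<zeta> / 2 * (w i * (k / t\<^sup>2))"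
  proof -
    have "D\<^sub>\<rho> * (left_end F - h) = (\<zeta> * w i * k / 2) * A"
      using zeta_pos wi k by (simp add: A_def)
    also have "\<dots> < (\<zeta> * w i * k / 2) * (1 / t)\<^sup>2"
      using At zeta_pos wi k by (intro mult_strict_left_mono) auto
    finally show ?thesis by (simp add: power_divide)
  qed
  moreover have "D\<^sub>\<rho> * (x - h) \<le> D\<^sub>\<rho> * (left_end F - h)"
    using x(1) D\<rho>_pos by (intro mult_left_mono) auto
  ultimately have "L h x < 0" by (subst L_eq) (auto simp: reg)
  moreover have "\<forall>y. x \<le> y \<and> y \<le> left_end F \<longrightarrow> isCont (L h) y"
    using tame DERIV_L DERIV_isCont by blast
  ultimately obtain y where y: "x \<le> y" "y \<le> left_end F" "L h y = 0"
    using IVT[of "L h" x 0 "left_end F"] assms(2) x(1) by auto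
  have "y \<in> S" using tame[OF y(1,2)] assms(1) by (force simp: tame_def scalar_dom_def u_def)
  then show ?thesis using y(3) by blast
qed

text \<open>The linear term vanishes at \<open>x = h\<close> and only the sum is left. The input
  therefore does not exceed the root, which makes it a valid start for Newton's method.\<close>

lemma L_at_input:
  assumes "h \<in> rising F"
  shows "L h h \<le> 0" and "mh \<noteq> 0 \<Longrightarrow> L h h < 0"
proof -
  have h: "h \<in> regular F" "h \<in> bounds F" using rising_subset[OF adm] assms by auto
  have "0 \<le> (\<Sum>j\<in>UNIV. w j * (mob1 F h / (u j h)\<^sup>2))"
    by (intro sum_nonneg summand_nonneg assms)
  then show "L h h \<le> 0" using zeta_pos by (simp add: L_eq[OF h(1)])
  assume "mh \<noteq> 0"
  then obtain i where "mh $ i \<noteq> 0" by (auto simp: vec_eq_iff)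
  then have "w i * (mob1 F h / (u i h)\<^sup>2) > 0"
    using w_pos mob1_pos[OF adm assms] u_pos[OF h(2), of i] by simp
  then have "0 < (\<Sum>j\<in>UNIV. w j * (mob1 F h / (u j h)\<^sup>2))"
    using summand_nonneg[OF assms] by (intro sum_pos2[of _ i]) auto
  then show "L h h < 0" using zeta_pos by (simp add: L_eq[OF h(1)])
qed

section \<open>Newton's method on the rising part\<close>

definition newton_ok :: "real \<Rightarrow> real \<Rightarrow> real \<Rightarrow> bool" where
  "newton_ok h a r \<longleftrightarrow> newton_converges (L h) S a r \<and> (\<lambda>n. mom (newton (L h) a n)) \<longlonglongrightarrow> mom r"

lemma tendsto_mom:
  assumes "x \<in> regular F \<inter> bounds F" "X \<longlonglongrightarrow> x"
  shows "(\<lambda>n. mom (X n)) \<longlonglongrightarrow> mom x"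
proof (rule vec_tendstoI)
  fix j
  have M: "(\<lambda>n. mob F (X n)) \<longlonglongrightarrow> mob F x"
    using assms DERIV_mob DERIV_isCont by (blast intro: isCont_tendsto_compose)
  have "D\<^sub>m $ j * mob F x + \<zeta> \<noteq> 0" using u_pos[of x j] assms(1) by (simp add: u_def)
  then have "(\<lambda>n. mob F (X n) * D\<^sub>m $ j * mh $ j / (D\<^sub>m $ j * mob F (X n) + \<zeta>))
      \<longlonglongrightarrow> mob F x * D\<^sub>m $ j * mh $ j / (D\<^sub>m $ j * mob F x + \<zeta>)"
    by (intro tendsto_intros M)
  then show "(\<lambda>n. mom (X n) $ j) \<longlonglongrightarrow> mom x $ j" by (simp add: momentum_def)
qed

text \<open>The whole interval from the start to the root stays in the rising part, where
  \<open>L1\<close> is positive and nonincreasing. For exponent 1 this part contains the left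
  endpoint, which is why the iteration may start there.\<close>

lemma newton_ok_rising:
  assumes "stationary h r" "r \<in> open_bounds F" "r \<in> rising F" "a \<in> rising F" "a \<le> r"
  shows "newton_ok h a r"
proof -
  have mem: "x \<in> rising F" if "a \<le> x" "x \<le> r" for x
    using rising_between[OF assms(4,3) that] .
  have reg: "x \<in> regular F \<inter> bounds F" if "a \<le> x" "x \<le> r" for x
    using mem[OF that] rising_subset[OF adm] by blast
  have tame: "x \<in> tame" if "a \<le> x" "x \<le> r" for x
    using mem[OF that] rising_subset_tame by blast
  have pos: "L1 x > 0" if "a \<le> x" "x \<le> r" for x
    using L1_ge[OF reg[OF that]] D\<rho>_pos by simp
  have dec: "L1 y \<le> L1 x" if "a \<le> x" "x \<le> y" "y \<le> r" for x y
  proof (rule DERIV_nonpos_imp_nonincreasing[OF that(2)])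
    fix z assume "x \<le> z" "z \<le> y"
    then have z: "a \<le> z" "z \<le> r" using that by auto
    show "\<exists>d. (L1 has_real_derivative d) (at z) \<and> d \<le> 0"
      using DERIV_L1[OF tame[OF z]] L2_nonpos[OF mem[OF z]] by blast
  qed
  have root: "L h r = 0" using assms(1,2) by (simp add: stationary_def)
  note newt = newton_concave_increasing[OF assms(5) root DERIV_L[OF tame] pos dec]
  have n: "newton (L h) a n \<in> {a..r}" for n by (rule newt(1))
  have lim: "newton (L h) a \<longlonglongrightarrow> r" by (rule newt(2))
  have "newton_converges (L h) S a r"
    unfolding newton_converges_def
  proof (intro conjI allI lim)
    fix n
    have x: "a \<le> newton (L h) a n" "newton (L h) a n \<le> r" using n[of n] by auto
    show "newton (L h) a n \<in> S" using reg[OF x] regular_bounds_subset_scalar_dom by blast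
    show "L h differentiable at (newton (L h) a n)"
      using DERIV_L[OF tame[OF x]] real_differentiable_def by blast
    show "deriv (L h) (newton (L h) a n) \<noteq> 0"
      using deriv_L[OF tame[OF x]] pos[OF x] by simp
  qed
  then show ?thesis
    unfolding newton_ok_def using tendsto_mom[OF reg[OF assms(5) order_refl] lim] by blast
qed

section \<open>Two-sided mobilities: midpoint and reflection\<close>

context
  fixes \<alpha> \<beta> \<xi> :: real
  assumes F: "F = Two_Sided \<alpha> \<beta> \<xi>"
begin

text \<open>Because \<open>mob1\<close> vanishes at the midpoint, \<open>L\<close> equals
  \<open>D\<^sub>\<rho> * (\<mu> - h) > 0\<close> there, so the sign change lies to its left; the
  assumption near \<alpha> keeps it off the endpoint.\<close>

lemma two_sided_left:
  assumes "stationary h r" "h < (\<alpha> + \<beta>) / 2" "eventually (\<lambda>x. L h x < 0) (at_right \<alpha>)"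
  shows "r \<in> {\<alpha><..<(\<alpha> + \<beta>) / 2}" "r \<in> open_bounds F" "r \<in> rising F"
proof -
  have "\<alpha> < r" using left_end_less_stationary[OF assms(1)] assms(3) by (simp add: F)
  define \<mu> where "\<mu> = (\<alpha> + \<beta>) / 2"
  have \<mu>: "\<mu> \<in> open_bounds F" using adm by (simp add: F \<mu>_def)
  have "mob1 F \<mu> = 0" by (simp add: F \<mu>_def)
  then have "L h \<mu> = D\<^sub>\<rho> * (\<mu> - h)"
    using L_eq[of \<mu> h] open_bounds_regular[OF \<mu>] by simp
  then have "L h \<mu> > 0" using assms(2) D\<rho>_pos by (simp add: \<mu>_def)
  then have "r < (\<alpha> + \<beta>) / 2" using stationary_greater[OF assms(1) \<mu>] by (simp add: \<mu>_def)
  then show "r \<in> {\<alpha><..<(\<alpha> + \<beta>) / 2}" "r \<in> open_bounds F" "r \<in> rising F"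
    using \<open>\<alpha> < r\<close> adm by (auto simp: F)
qed

lemma two_sided_middle:
  assumes "stationary ((\<alpha> + \<beta>) / 2) r"
  shows "r = (\<alpha> + \<beta>) / 2" "r \<in> open_bounds F"
proof -
  define \<mu> where "\<mu> = (\<alpha> + \<beta>) / 2"
  have \<mu>: "\<mu> \<in> open_bounds F" using adm by (simp add: F \<mu>_def)
  have "mob1 F \<mu> = 0" by (simp add: F \<mu>_def)
  then have "L \<mu> \<mu> = 0"
    using L_eq[of \<mu> \<mu>] open_bounds_regular[OF \<mu>] by simp
  then have "r = \<mu>"
    using stationary_root[OF assms[folded \<mu>_def] open_bounds_regular[OF \<mu>]] by blast
  then show "r \<in> open_bounds F" "r = (\<alpha> + \<beta>) / 2" using \<mu> unfolding \<mu>_def by blast+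
qed

lemma regular_reflect: "\<alpha> + \<beta> - x \<in> regular F \<longleftrightarrow> x \<in> regular F"
  and bounds_reflect: "\<alpha> + \<beta> - x \<in> bounds F \<longleftrightarrow> x \<in> bounds F"
  and open_bounds_reflect: "\<alpha> + \<beta> - x \<in> open_bounds F \<longleftrightarrow> x \<in> open_bounds F"
  by (auto simp: F)

lemma scalar_dom_reflect: "\<alpha> + \<beta> - x \<in> S \<longleftrightarrow> x \<in> S"
  using bounds_reflect[of x] mob_reflect[of \<alpha> \<beta> \<xi> x] by (simp only: scalar_dom_def F mem_Collect_eq)

lemma mom_reflect: "mom (\<alpha> + \<beta> - x) = mom x"
  using mob_reflect[of \<alpha> \<beta> \<xi> x] by (simp only: momentum_def F)

lemma L_reflect:
  assumes "x \<in> regular F"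
  shows "L h x = - L (\<alpha> + \<beta> - h) (\<alpha> + \<beta> - x)"
proof -
  have "mob F (\<alpha> + \<beta> - x) = mob F x"
    using mob_reflect[of \<alpha> \<beta> \<xi> x] by (simp only: F)
  then have "u j (\<alpha> + \<beta> - x) = u j x" for j
    by (simp only: u_def)
  moreover have "mob1 F (\<alpha> + \<beta> - x) = - mob1 F x"
    using mob1_reflect[of \<alpha> \<beta> \<xi> x] by (simp only: F)
  ultimately show ?thesis
    using assms regular_reflect[of x]
    by (simp add: L_eq sum_negf) (simp add: algebra_simps)
qed

lemma stationary_reflect:
  assumes "stationary h r"
  shows "stationary (\<alpha> + \<beta> - h) (\<alpha> + \<beta> - r)"
  unfolding stationary_def bounds_reflect open_bounds_reflect
proof (intro conjI impI ballI)
  show "r \<in> bounds F" using assms by (simp add: stationary_def)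
  show "L (\<alpha> + \<beta> - h) (\<alpha> + \<beta> - r) = 0" if "r \<in> open_bounds F"
    using assms that L_reflect[of r h] open_bounds_regular[OF that] by (simp add: stationary_def)
  fix x assume x: "x \<in> open_bounds F"
  then have x': "\<alpha> + \<beta> - x \<in> open_bounds F" by (simp add: open_bounds_reflect)
  have eq: "L h (\<alpha> + \<beta> - x) = - L (\<alpha> + \<beta> - h) x"
    using L_reflect[of "\<alpha> + \<beta> - x" h] open_bounds_regular[OF x'] by simp
  show "L (\<alpha> + \<beta> - h) x < 0" if "x < \<alpha> + \<beta> - r"
    using assms x' eq that unfolding stationary_def by force
  show "L (\<alpha> + \<beta> - h) x > 0" if "\<alpha> + \<beta> - r < x"
    using assms x' eq that unfolding stationary_def by force
qed

lemma two_sided_right: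
  assumes "stationary h r" "h > (\<alpha> + \<beta>) / 2"
    and "eventually (\<lambda>x. L (\<alpha> + \<beta> - h) x < 0) (at_right \<alpha>)"
  shows "r \<in> {(\<alpha> + \<beta>) / 2<..<\<beta>}" "r \<in> open_bounds F" "\<alpha> + \<beta> - r \<in> rising F"
proof -
  have "\<alpha> + \<beta> - h < (\<alpha> + \<beta>) / 2" using assms(2) by (simp add: field_simps)
  note left = two_sided_left[OF stationary_reflect[OF assms(1)] this assms(3)]
  show "r \<in> {(\<alpha> + \<beta>) / 2<..<\<beta>}" "r \<in> open_bounds F" "\<alpha> + \<beta> - r \<in> rising F"
    using left by (auto simp: open_bounds_reflect field_simps)
qed

lemma second_deriv_pos_L:
  assumes "mh \<noteq> 0"
  shows "second_deriv_pos (L h) {(\<alpha> + \<beta>) / 2<..<\<beta>}"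
proof (rule second_deriv_pos_reflect)
  show "second_deriv_neg (L (\<alpha> + \<beta> - h)) {\<alpha><..<(\<alpha> + \<beta>) / 2}"
    using assms by (rule second_deriv_neg_L) (auto simp: F)
  show "L h y = - L (\<alpha> + \<beta> - h) (\<alpha> + \<beta> - y)" if "y \<in> {(\<alpha> + \<beta>) / 2<..<\<beta>}" for y
    using that adm by (intro L_reflect) (auto simp: F)
qed (auto simp: field_simps)

text \<open>The mobility, and with it \<open>mom\<close>, is invariant under the reflection, so both
  problems produce the same sequence of momenta.\<close>

lemma newton_ok_reflect:
  assumes "newton_ok (\<alpha> + \<beta> - h) a r"
  shows "newton_ok h (\<alpha> + \<beta> - a) (\<alpha> + \<beta> - r)"
proof -
  have conv: "newton_converges (L (\<alpha> + \<beta> - h)) S a r"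
    and mom: "(\<lambda>n. mom (newton (L (\<alpha> + \<beta> - h)) a n)) \<longlonglongrightarrow> mom r"
    using assms by (auto simp: newton_ok_def)
  have dom: "\<alpha> + \<beta> - x \<in> S \<inter> regular F" if "x \<in> S" for x
    using that scalar_dom_subset by (auto simp: scalar_dom_reflect regular_reflect)
  have seq: "newton (L h) (\<alpha> + \<beta> - a) = (\<lambda>n. \<alpha> + \<beta> - newton (L (\<alpha> + \<beta> - h)) a n)"
    by (rule newton_converges_reflect(1)[OF conv open_regular dom L_reflect])
  have "newton_converges (L h) S (\<alpha> + \<beta> - a) (\<alpha> + \<beta> - r)"
    by (rule newton_converges_reflect(2)[OF conv open_regular dom L_reflect])
  then show ?thesis
    unfolding newton_ok_def seq mom_reflect using mom by blast
qed

end

end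

text \<open>For \<open>mh = 0\<close> the function \<open>L\<close> is affine with root \<rho>h: its
  second derivative is zero, and there is no interior root when \<rho>h lies outside the open
  bounds. The conditions on \<open>mh\<close> exclude these cases. For exponent 1 \<open>L\<close>
  may have further roots beyond its poles, so uniqueness is claimed for
  \<open>R \<inter> bounds F\<close>. A small \<delta> is expressed by
  \<open>at_right 0\<close>.\<close>

theorem theorem4p1:
  fixes F :: mobility
    and D\<^sub>\<rho> \<zeta> \<rho>h C\<^sub>1 :: real
    and D\<^sub>m mh :: "real ^ 'd"
    and L :: "real \<Rightarrow> real"
    and S R :: "real set"
    and mom :: "real \<Rightarrow> real ^ 'd"
    and C\<^sub>2 \<rho>\<^sub>m :: "real \<Rightarrow> real \<Rightarrow> real"
    and sol :: "real \<times> (real ^ 'd) \<Rightarrow> bool"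
    and conv :: "real \<Rightarrow> real \<Rightarrow> real ^ 'd \<Rightarrow> bool"
  assumes "D\<^sub>\<rho> > 0" and "\<And>j. D\<^sub>m $ j > 0" and "\<zeta> > 0"
    and "admissible F"
    and sol_def: "sol = is_arg_min (objective F D\<^sub>\<rho> D\<^sub>m \<zeta> \<rho>h mh) (\<lambda>_. True)"
    and L_def: "L = scalar_fun F D\<^sub>\<rho> D\<^sub>m \<zeta> \<rho>h mh"
    and S_def: "S = scalar_dom F D\<^sub>m \<zeta> mh"
    and R_def: "R = {\<rho> \<in> S. L \<rho> = 0}"
    and mom_def: "mom = momentum F D\<^sub>m \<zeta> mh"
    and conv_def: "conv = (\<lambda>\<rho>0 \<rho>s ms. newton_converges L S \<rho>0 \<rho>s
                              \<and> (\<lambda>n. mom (newton L \<rho>0 n)) \<longlonglongrightarrow> ms)"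
    and C1_def: "C\<^sub>1 = - 1 / (2 * \<zeta> * D\<^sub>\<rho>) * (\<Sum>j\<in>UNIV. (D\<^sub>m $ j * mh $ j)\<^sup>2)"
    and C2_def: "C\<^sub>2 = (\<lambda>\<alpha> \<beta>. (\<beta> - \<alpha>) / (2 * \<zeta> * D\<^sub>\<rho>) * (\<Sum>j\<in>UNIV. (D\<^sub>m $ j * mh $ j)\<^sup>2))"
    and \<rho>m_def: "\<rho>\<^sub>m = (\<lambda>\<alpha> \<beta>. (\<alpha> + \<beta>) / 2)"
  shows
    \<comment> \<open>(A)\<close>
    "(\<exists>!p. sol p) \<and>
     (\<forall>\<rho>s ms. sol (\<rho>s, ms) \<longrightarrow>
        \<rho>s \<in> bounds F \<and> mob F \<rho>s \<ge> 0 \<and>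
        (\<forall>\<rho> \<in> R \<inter> bounds F. \<rho>s = \<rho>) \<and> (R \<inter> bounds F = {} \<longrightarrow> mob F \<rho>s = 0) \<and>
        ms = mom \<rho>s \<and>
     \<comment> \<open>(B)\<close>
     (\<forall>\<xi> \<delta>. F = One_Sided \<xi> \<and> \<xi> < 1 \<and> \<delta> > 0 \<longrightarrow>
        (\<rho>h \<le> \<delta> \<longrightarrow>
           (mh \<noteq> 0 \<or> 0 < \<rho>h \<longrightarrow> R \<inter> bounds F = {\<rho>s} \<and> \<rho>s \<in> {0<..}) \<and>
           (mh \<noteq> 0 \<longrightarrow> second_deriv_neg L {0<..})) \<and>
        (\<rho>h > \<delta> \<longrightarrow>
           (mh \<noteq> 0 \<longrightarrow> R \<inter> bounds F = {\<rho>s} \<and> \<rho>s \<in> {\<rho>h<..}) \<and>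
           (mh \<noteq> 0 \<longrightarrow> second_deriv_neg L {\<rho>h<..}))) \<and>
     (F = One_Sided 1 \<longrightarrow>
        (\<rho>h \<le> C\<^sub>1 \<longrightarrow> R \<noteq> {} \<and> R \<subseteq> {..0} \<and> \<rho>s = 0) \<and>
        (\<rho>h > C\<^sub>1 \<longrightarrow>
           R \<inter> bounds F = {\<rho>s} \<and> \<rho>s \<in> {0<..} \<and>
           (mh \<noteq> 0 \<longrightarrow> second_deriv_neg L {0<..}))) \<and>
     (\<forall>\<alpha> \<beta> \<xi>. F = Two_Sided \<alpha> \<beta> \<xi> \<and> \<xi> < 1 \<longrightarrow>
        (\<rho>h < \<rho>\<^sub>m \<alpha> \<beta> \<longrightarrow>
           (mh \<noteq> 0 \<or> \<alpha> < \<rho>h \<longrightarrow> R \<inter> bounds F = {\<rho>s} \<and> \<rho>s \<in> {\<alpha><..<\<rho>\<^sub>m \<alpha> \<beta>}) \<and>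
           (mh \<noteq> 0 \<longrightarrow> second_deriv_neg L {\<alpha><..<\<rho>\<^sub>m \<alpha> \<beta>})) \<and>
        (\<rho>h = \<rho>\<^sub>m \<alpha> \<beta> \<longrightarrow> R \<inter> bounds F = {\<rho>\<^sub>m \<alpha> \<beta>} \<and> \<rho>s = \<rho>\<^sub>m \<alpha> \<beta>) \<and>
        (\<rho>h > \<rho>\<^sub>m \<alpha> \<beta> \<longrightarrow>
           (mh \<noteq> 0 \<or> \<rho>h < \<beta> \<longrightarrow> R \<inter> bounds F = {\<rho>s} \<and> \<rho>s \<in> {\<rho>\<^sub>m \<alpha> \<beta><..<\<beta>}) \<and>
           (mh \<noteq> 0 \<longrightarrow> second_deriv_pos L {\<rho>\<^sub>m \<alpha> \<beta><..<\<beta>}))) \<and>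
     (\<forall>\<alpha> \<beta>. F = Two_Sided \<alpha> \<beta> 1 \<longrightarrow>
        (\<rho>h \<le> \<alpha> - C\<^sub>2 \<alpha> \<beta> \<longrightarrow> R \<noteq> {} \<and> R \<subseteq> {..\<alpha>} \<and> \<rho>s = \<alpha>) \<and>
        (\<alpha> - C\<^sub>2 \<alpha> \<beta> < \<rho>h \<and> \<rho>h < \<rho>\<^sub>m \<alpha> \<beta> \<longrightarrow>
           R \<inter> bounds F = {\<rho>s} \<and> \<rho>s \<in> {\<alpha><..<\<rho>\<^sub>m \<alpha> \<beta>} \<and>
           (mh \<noteq> 0 \<longrightarrow> second_deriv_neg L {\<alpha><..<\<rho>\<^sub>m \<alpha> \<beta>})) \<and>
        (\<rho>h = \<rho>\<^sub>m \<alpha> \<beta> \<longrightarrow> R \<inter> bounds F = {\<rho>\<^sub>m \<alpha> \<beta>} \<and> \<rho>s = \<rho>\<^sub>m \<alpha> \<beta>) \<and>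
        (\<rho>\<^sub>m \<alpha> \<beta> < \<rho>h \<and> \<rho>h < \<beta> + C\<^sub>2 \<alpha> \<beta> \<longrightarrow>
           R \<inter> bounds F = {\<rho>s} \<and> \<rho>s \<in> {\<rho>\<^sub>m \<alpha> \<beta><..<\<beta>} \<and>
           (mh \<noteq> 0 \<longrightarrow> second_deriv_pos L {\<rho>\<^sub>m \<alpha> \<beta><..<\<beta>})) \<and>
        (\<rho>h \<ge> \<beta> + C\<^sub>2 \<alpha> \<beta> \<longrightarrow> R \<noteq> {} \<and> R \<subseteq> {\<beta>..} \<and> \<rho>s = \<beta>)) \<and>
     \<comment> \<open>(C)\<close>
     (\<forall>\<xi>. F = One_Sided \<xi> \<and> \<xi> < 1 \<longrightarrow>
        (\<forall>\<^sub>F \<delta> in at_right 0.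
           (\<rho>h \<le> \<delta> \<and> (mh \<noteq> 0 \<or> 0 < \<rho>h) \<longrightarrow> conv \<delta> \<rho>s ms) \<and>
           (\<rho>h > \<delta> \<longrightarrow> conv \<rho>h \<rho>s ms))) \<and>
     (F = One_Sided 1 \<and> \<rho>h > C\<^sub>1 \<longrightarrow> conv 0 \<rho>s ms) \<and>
     (\<forall>\<alpha> \<beta> \<xi>. F = Two_Sided \<alpha> \<beta> \<xi> \<and> \<xi> < 1 \<longrightarrow>
        (\<forall>\<^sub>F \<delta> in at_right 0.
           (\<rho>h < \<rho>\<^sub>m \<alpha> \<beta> \<and> (mh \<noteq> 0 \<or> \<alpha> < \<rho>h) \<longrightarrow> conv (\<alpha> + \<delta>) \<rho>s ms) \<and>
           (\<rho>h > \<rho>\<^sub>m \<alpha> \<beta> \<and> (mh \<noteq> 0 \<or> \<rho>h < \<beta>) \<longrightarrow> conv (\<beta> - \<delta>) \<rho>s ms))) \<and>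
     (\<forall>\<alpha> \<beta>. F = Two_Sided \<alpha> \<beta> 1 \<longrightarrow>
        (\<alpha> - C\<^sub>2 \<alpha> \<beta> < \<rho>h \<and> \<rho>h < \<rho>\<^sub>m \<alpha> \<beta> \<longrightarrow> conv \<alpha> \<rho>s ms) \<and>
        (\<rho>\<^sub>m \<alpha> \<beta> < \<rho>h \<and> \<rho>h < \<beta> + C\<^sub>2 \<alpha> \<beta> \<longrightarrow> conv \<beta> \<rho>s ms)))"
proof -
  interpret P: mobility_problem F D\<^sub>\<rho> \<zeta> D\<^sub>m mh
    using assms by unfold_locales auto
  obtain r where r: "P.stationary \<rho>h r" using P.stationary_exists by blast
  have rb: "r \<in> bounds F" using r by (simp add: P.stationary_def)
  have sol: "sol p \<longleftrightarrow> p = (r, mom r)" for p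
    unfolding sol_def mom_def by (rule P.is_arg_min_iff[OF r])
  have conv: "conv a r (mom r)" if "P.newton_ok \<rho>h a r" for a
    using that unfolding conv_def P.newton_ok_def L_def S_def mom_def by blast
  have R_eq: "R = {x \<in> P.S. P.L \<rho>h x = 0}" by (simp add: R_def L_def S_def)
  have roots: "R \<inter> bounds F = {r}" if "r \<in> open_bounds F"
    using P.stationary_roots[OF r that] by (simp add: R_eq)
  have W: "(\<Sum>j\<in>UNIV. (D\<^sub>m $ j * mh $ j)\<^sup>2) = (\<Sum>j\<in>UNIV. P.w j)" by (simp add: P.w_def)
  have neg: "eventually (\<lambda>x. P.L h x < 0) (at_right (left_end F))"
    if "exponent F \<noteq> 1" "mh \<noteq> 0 \<or> left_end F < h" for h
    using that P.eventually_L_neg_singular P.eventually_L_neg_mh_0 by blast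
  have ex1: "\<exists>!p. sol p" by (simp add: sol)
  have unique: "\<forall>\<rho> \<in> R \<inter> bounds F. r = \<rho>"
    using P.stationary_root[OF r] P.scalar_dom_subset by (auto simp: R_eq)
  have vanish: "R \<inter> bounds F = {} \<longrightarrow> mob F r = 0"
    using roots mob_pos_iff[OF \<open>admissible F\<close> rb] mob_nonneg[OF rb] by auto

  have row1: "\<forall>\<xi> \<delta>. F = One_Sided \<xi> \<and> \<xi> < 1 \<and> \<delta> > 0 \<longrightarrow>
        (\<rho>h \<le> \<delta> \<longrightarrow>
           (mh \<noteq> 0 \<or> 0 < \<rho>h \<longrightarrow> R \<inter> bounds F = {r} \<and> r \<in> {0<..}) \<and>
           (mh \<noteq> 0 \<longrightarrow> second_deriv_neg L {0<..})) \<and>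
        (\<rho>h > \<delta> \<longrightarrow>
           (mh \<noteq> 0 \<longrightarrow> R \<inter> bounds F = {r} \<and> r \<in> {\<rho>h<..}) \<and>
           (mh \<noteq> 0 \<longrightarrow> second_deriv_neg L {\<rho>h<..}))" (is "\<forall>\<xi> \<delta>. ?h1 \<xi> \<delta> \<longrightarrow> ?row1 \<xi> \<delta>")
    and newton1: "\<forall>\<xi>. F = One_Sided \<xi> \<and> \<xi> < 1 \<longrightarrow>
        (\<forall>\<^sub>F \<delta> in at_right 0.
           (\<rho>h \<le> \<delta> \<and> (mh \<noteq> 0 \<or> 0 < \<rho>h) \<longrightarrow> conv \<delta> r (mom r)) \<and>
           (\<rho>h > \<delta> \<longrightarrow> conv \<rho>h r (mom r)))" (is ?newton1)
  proof -
    have pos: "0 < r" if "F = One_Sided \<xi>" "\<xi> < 1" "mh \<noteq> 0 \<or> 0 < \<rho>h" for \<xi>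
      using P.left_end_less_stationary[OF r neg] that by simp
    have input: "P.L \<rho>h \<rho>h \<le> 0" "mh \<noteq> 0 \<Longrightarrow> P.L \<rho>h \<rho>h < 0"
      if "F = One_Sided \<xi>" "\<xi> < 1" "0 < \<rho>h" for \<xi>
      using P.L_at_input[of \<rho>h] that by auto
    have above: "\<rho>h < r" if "F = One_Sided \<xi>" "\<xi> < 1" "0 < \<rho>h" "mh \<noteq> 0" for \<xi>
      using P.stationary_less[OF r _ input(2)[OF that]] that by simp
    \<comment> \<open>For \<open>mh = 0\<close> the input itself is the root, so the inequality is
      weak; the iteration then starts at the solution.\<close>
    have above': "\<rho>h \<le> r" if "F = One_Sided \<xi>" "\<xi> < 1" "0 < \<rho>h" for \<xi>
      using r input(1)[OF that] that unfolding P.stationary_def by force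
    show "\<forall>\<xi> \<delta>. ?h1 \<xi> \<delta> \<longrightarrow> ?row1 \<xi> \<delta>"
    proof (intro allI impI, elim conjE)
      fix \<xi> \<delta> :: real assume F: "F = One_Sided \<xi>" "\<xi> < 1" and "\<delta> > 0"
      have "R \<inter> bounds F = {r}" "0 < r" if "mh \<noteq> 0 \<or> 0 < \<rho>h"
        using pos[OF F that] roots F by auto
      moreover have "second_deriv_neg L I" if "mh \<noteq> 0" "I \<subseteq> {0<..}" for I
        unfolding L_def using that F by (intro P.second_deriv_neg_L) auto
      moreover have "{\<rho>h<..} \<subseteq> {0<..}" "0 < \<rho>h" if "\<rho>h > \<delta>"
        using that \<open>\<delta> > 0\<close> by auto
      ultimately show "?row1 \<xi> \<delta>" using above[OF F] by simp
    qed
    show ?newton1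
    proof (intro allI impI, elim conjE)
      fix \<xi> :: real assume F: "F = One_Sided \<xi>" "\<xi> < 1"
      \<comment> \<open>For \<open>mh = 0\<close> and a nonpositive input the solution is 0; the
        guard \<open>0 < r\<close> keeps the statement valid then.\<close>
      have "\<forall>\<^sub>F \<delta> in at_right 0. 0 < \<delta> \<and> (0 < r \<longrightarrow> \<delta> < r)"
        by (cases "0 < r")
          (auto intro: eventually_mono[OF eventually_at_right_real] simp: eventually_at_right_less)
      then show "\<forall>\<^sub>F \<delta> in at_right 0.
           (\<rho>h \<le> \<delta> \<and> (mh \<noteq> 0 \<or> 0 < \<rho>h) \<longrightarrow> conv \<delta> r (mom r)) \<and>
           (\<rho>h > \<delta> \<longrightarrow> conv \<rho>h r (mom r))"
      proof eventually_elim
        case (elim \<delta>)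
        have ok: "conv a r (mom r)" if "0 < a" "a \<le> r" for a
          using that F by (intro conv P.newton_ok_rising[OF r]) auto
        have "conv \<delta> r (mom r)" if "mh \<noteq> 0 \<or> 0 < \<rho>h"
          using ok[of \<delta>] elim pos[OF F that] by auto
        moreover have "conv \<rho>h r (mom r)" if "\<rho>h > \<delta>"
          using ok[of \<rho>h] elim above'[OF F] that by auto
        ultimately show ?case by blast
      qed
    qed
  qed

  have row2: "F = One_Sided 1 \<longrightarrow>
        (\<rho>h \<le> C\<^sub>1 \<longrightarrow> R \<noteq> {} \<and> R \<subseteq> {..0} \<and> r = 0) \<and>
        (\<rho>h > C\<^sub>1 \<longrightarrow>
           R \<inter> bounds F = {r} \<and> r \<in> {0<..} \<and>
           (mh \<noteq> 0 \<longrightarrow> second_deriv_neg L {0<..}))" (is ?row2)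
    and newton2: "F = One_Sided 1 \<and> \<rho>h > C\<^sub>1 \<longrightarrow> conv 0 r (mom r)" (is ?newton2)
  proof -
    have thr: "P.L \<rho>h (left_end F) = D\<^sub>\<rho> * (C\<^sub>1 - \<rho>h)" if "F = One_Sided 1"
    proof -
      have "D\<^sub>\<rho> * (C\<^sub>1 - \<rho>h) = D\<^sub>\<rho> * (0 - \<rho>h) - 1 / (2 * \<zeta>) * (\<Sum>j\<in>UNIV. P.w j)"
        unfolding C1_def W using \<open>D\<^sub>\<rho> > 0\<close> \<open>\<zeta> > 0\<close> by (simp add: field_simps)
      then show ?thesis using P.L_left_end[of \<rho>h] that by simp
    qed
    have low: "R \<noteq> {}" "R \<subseteq> {..0}" "r = 0" if F: "F = One_Sided 1" and h: "\<rho>h \<le> C\<^sub>1"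
    proof -
      have nn: "P.L \<rho>h (left_end F) \<ge> 0" unfolding thr[OF F] using h \<open>D\<^sub>\<rho> > 0\<close> by simp
      have e: "exponent F = 1" using F by simp
      show "R \<noteq> {}" using P.root_left_of_left_end[OF e nn] by (auto simp: R_eq)
      show "R \<subseteq> {..0}" using P.root_le_left_end[OF e nn] F by (auto simp: R_eq)
      show "r = 0" using P.stationary_eq_left_end[OF r e nn] F by simp
    qed
    have pos: "0 < r" if F: "F = One_Sided 1" and h: "\<rho>h > C\<^sub>1"
    proof -
      have "P.L \<rho>h (left_end F) < 0" unfolding thr[OF F] using h \<open>D\<^sub>\<rho> > 0\<close> by (simp add: mult_pos_neg)
      then show ?thesis
        using P.left_end_less_stationary[OF r P.eventually_L_neg_smooth] F by simp
    qed
    have "second_deriv_neg L {0<..}" if "F = One_Sided 1" "mh \<noteq> 0"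
      unfolding L_def using that by (intro P.second_deriv_neg_L) auto
    then show ?row2
      using low pos roots by auto
    show ?newton2
    proof (intro impI conv P.newton_ok_rising[OF r])
    qed (use pos in auto)
  qed

  have left: "r \<in> {\<alpha><..<\<rho>\<^sub>m \<alpha> \<beta>}" "R \<inter> bounds F = {r}"
      "a \<in> rising F \<Longrightarrow> a \<le> r \<Longrightarrow> conv a r (mom r)"
    if F: "F = Two_Sided \<alpha> \<beta> \<xi>" and h: "\<rho>h < \<rho>\<^sub>m \<alpha> \<beta>"
      and ev: "eventually (\<lambda>x. P.L \<rho>h x < 0) (at_right (left_end F))" for \<alpha> \<beta> \<xi> a
  proof -
    have "eventually (\<lambda>x. P.L \<rho>h x < 0) (at_right \<alpha>)" using ev F by simp
    note l = P.two_sided_left[OF F r h[unfolded \<rho>m_def] this]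
    show "r \<in> {\<alpha><..<\<rho>\<^sub>m \<alpha> \<beta>}" "R \<inter> bounds F = {r}" using l(1) roots[OF l(2)] by (auto simp: \<rho>m_def)
    show "a \<in> rising F \<Longrightarrow> a \<le> r \<Longrightarrow> conv a r (mom r)"
      by (intro conv P.newton_ok_rising[OF r l(2,3)])
  qed
  have right: "r \<in> {\<rho>\<^sub>m \<alpha> \<beta><..<\<beta>}" "R \<inter> bounds F = {r}"
      "\<alpha> + \<beta> - a \<in> rising F \<Longrightarrow> r \<le> a \<Longrightarrow> conv a r (mom r)"
    if F: "F = Two_Sided \<alpha> \<beta> \<xi>" and h: "\<rho>h > \<rho>\<^sub>m \<alpha> \<beta>"
      and ev: "eventually (\<lambda>x. P.L (\<alpha> + \<beta> - \<rho>h) x < 0) (at_right (left_end F))" for \<alpha> \<beta> \<xi> a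
  proof -
    have "eventually (\<lambda>x. P.L (\<alpha> + \<beta> - \<rho>h) x < 0) (at_right \<alpha>)" using ev F by simp
    note l = P.two_sided_right[OF F r h[unfolded \<rho>m_def] this]
    show "r \<in> {\<rho>\<^sub>m \<alpha> \<beta><..<\<beta>}" "R \<inter> bounds F = {r}" using l(1) roots[OF l(2)] by (auto simp: \<rho>m_def)
    assume a: "\<alpha> + \<beta> - a \<in> rising F" "r \<le> a"
    \<comment> \<open>An approach to \<open>r\<close> from the right is, in the reflected problem,
      an approach from the left on the rising part.\<close>
    have "P.newton_ok (\<alpha> + \<beta> - \<rho>h) (\<alpha> + \<beta> - a) (\<alpha> + \<beta> - r)"
      using P.newton_ok_rising[OF P.stationary_reflect[OF F r] _ l(3) a(1)] l(2) a(2)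
      by (simp add: P.open_bounds_reflect[OF F])
    from P.newton_ok_reflect[OF F this] show "conv a r (mom r)"
      by (intro conv) simp
  qed
  have middle: "R \<inter> bounds F = {\<rho>\<^sub>m \<alpha> \<beta>} \<and> r = \<rho>\<^sub>m \<alpha> \<beta>"
    if F: "F = Two_Sided \<alpha> \<beta> \<xi>" and h: "\<rho>h = \<rho>\<^sub>m \<alpha> \<beta>" for \<alpha> \<beta> \<xi>
    using P.two_sided_middle[OF F, of r] roots r h by (auto simp: \<rho>m_def)
  have snd_neg: "second_deriv_neg L {\<alpha><..<\<rho>\<^sub>m \<alpha> \<beta>}"
    if "F = Two_Sided \<alpha> \<beta> \<xi>" "mh \<noteq> 0" for \<alpha> \<beta> \<xi>
    unfolding L_def using that by (intro P.second_deriv_neg_L) (auto simp: \<rho>m_def)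
  have snd_pos: "second_deriv_pos L {\<rho>\<^sub>m \<alpha> \<beta><..<\<beta>}"
    if "F = Two_Sided \<alpha> \<beta> \<xi>" "mh \<noteq> 0" for \<alpha> \<beta> \<xi>
    unfolding L_def \<rho>m_def using P.second_deriv_pos_L[OF that] by simp

  have row3: "\<forall>\<alpha> \<beta> \<xi>. F = Two_Sided \<alpha> \<beta> \<xi> \<and> \<xi> < 1 \<longrightarrow>
        (\<rho>h < \<rho>\<^sub>m \<alpha> \<beta> \<longrightarrow>
           (mh \<noteq> 0 \<or> \<alpha> < \<rho>h \<longrightarrow> R \<inter> bounds F = {r} \<and> r \<in> {\<alpha><..<\<rho>\<^sub>m \<alpha> \<beta>}) \<and>
           (mh \<noteq> 0 \<longrightarrow> second_deriv_neg L {\<alpha><..<\<rho>\<^sub>m \<alpha> \<beta>})) \<and>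
        (\<rho>h = \<rho>\<^sub>m \<alpha> \<beta> \<longrightarrow> R \<inter> bounds F = {\<rho>\<^sub>m \<alpha> \<beta>} \<and> r = \<rho>\<^sub>m \<alpha> \<beta>) \<and>
        (\<rho>h > \<rho>\<^sub>m \<alpha> \<beta> \<longrightarrow>
           (mh \<noteq> 0 \<or> \<rho>h < \<beta> \<longrightarrow> R \<inter> bounds F = {r} \<and> r \<in> {\<rho>\<^sub>m \<alpha> \<beta><..<\<beta>}) \<and>
           (mh \<noteq> 0 \<longrightarrow> second_deriv_pos L {\<rho>\<^sub>m \<alpha> \<beta><..<\<beta>}))" (is "\<forall>\<alpha> \<beta> \<xi>. ?h3 \<alpha> \<beta> \<xi> \<longrightarrow> ?row3 \<alpha> \<beta> \<xi>")
    and newton3: "\<forall>\<alpha> \<beta> \<xi>. F = Two_Sided \<alpha> \<beta> \<xi> \<and> \<xi> < 1 \<longrightarrow>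
        (\<forall>\<^sub>F \<delta> in at_right 0.
           (\<rho>h < \<rho>\<^sub>m \<alpha> \<beta> \<and> (mh \<noteq> 0 \<or> \<alpha> < \<rho>h) \<longrightarrow> conv (\<alpha> + \<delta>) r (mom r)) \<and>
           (\<rho>h > \<rho>\<^sub>m \<alpha> \<beta> \<and> (mh \<noteq> 0 \<or> \<rho>h < \<beta>) \<longrightarrow> conv (\<beta> - \<delta>) r (mom r)))" (is ?newton3)
  proof -
    have ev_left: "eventually (\<lambda>x. P.L \<rho>h x < 0) (at_right (left_end F))"
      if "F = Two_Sided \<alpha> \<beta> \<xi>" "\<xi> < 1" "mh \<noteq> 0 \<or> \<alpha> < \<rho>h" for \<alpha> \<beta> \<xi>
      using neg[of \<rho>h] that by simp
    have ev_right: "eventually (\<lambda>x. P.L (\<alpha> + \<beta> - \<rho>h) x < 0) (at_right (left_end F))"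
      if "F = Two_Sided \<alpha> \<beta> \<xi>" "\<xi> < 1" "mh \<noteq> 0 \<or> \<rho>h < \<beta>" for \<alpha> \<beta> \<xi>
      using neg[of "\<alpha> + \<beta> - \<rho>h"] that by simp
    show "\<forall>\<alpha> \<beta> \<xi>. ?h3 \<alpha> \<beta> \<xi> \<longrightarrow> ?row3 \<alpha> \<beta> \<xi>"
    proof (intro allI impI, elim conjE)
      fix \<alpha> \<beta> \<xi> :: real assume F: "F = Two_Sided \<alpha> \<beta> \<xi>" "\<xi> < 1"
      show "?row3 \<alpha> \<beta> \<xi>"
        using left(1,2)[OF F(1) _ ev_left[OF F]] right(1,2)[OF F(1) _ ev_right[OF F]]
          middle[OF F(1)] snd_neg[OF F(1)] snd_pos[OF F(1)]
        by meson
    qed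
    show ?newton3
    proof (intro allI impI, elim conjE)
      fix \<alpha> \<beta> \<xi> :: real assume F: "F = Two_Sided \<alpha> \<beta> \<xi>" "\<xi> < 1"
      have less: "\<forall>\<^sub>F \<delta> in at_right 0. 0 < \<delta> \<and> (0 < c \<longrightarrow> \<delta> < c)" for c :: real
        by (cases "0 < c")
          (auto intro: eventually_mono[OF eventually_at_right_real] simp: eventually_at_right_less)
      show "\<forall>\<^sub>F \<delta> in at_right 0.
           (\<rho>h < \<rho>\<^sub>m \<alpha> \<beta> \<and> (mh \<noteq> 0 \<or> \<alpha> < \<rho>h) \<longrightarrow> conv (\<alpha> + \<delta>) r (mom r)) \<and>
           (\<rho>h > \<rho>\<^sub>m \<alpha> \<beta> \<and> (mh \<noteq> 0 \<or> \<rho>h < \<beta>) \<longrightarrow> conv (\<beta> - \<delta>) r (mom r))"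
        \<comment> \<open>Below these distances the start lies between its endpoint and
          \<open>r\<close>, the side from which the iteration is monotone.\<close>
        using less[of "r - \<alpha>"] less[of "\<beta> - r"]
      proof eventually_elim
        case (elim \<delta>)
        have "conv (\<alpha> + \<delta>) r (mom r)" if "\<rho>h < \<rho>\<^sub>m \<alpha> \<beta>" "mh \<noteq> 0 \<or> \<alpha> < \<rho>h"
        proof -
          note l = left[OF F(1) that(1) ev_left[OF F that(2)]]
          have \<delta>: "0 < \<delta>" "\<alpha> + \<delta> < r" using elim(1) l(1) by auto
          have "\<alpha> + \<delta> \<in> rising F" using \<delta> l(1) F by (auto simp: \<rho>m_def)
          then show ?thesis using l(3) \<delta>(2) by simp
        qed
        moreover have "conv (\<beta> - \<delta>) r (mom r)" if "\<rho>h > \<rho>\<^sub>m \<alpha> \<beta>" "mh \<noteq> 0 \<or> \<rho>h < \<beta>"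
        proof -
          note l = right[OF F(1) that(1) ev_right[OF F that(2)]]
          have \<delta>: "0 < \<delta>" "r < \<beta> - \<delta>" using elim(2) l(1) by auto
          have "\<alpha> + \<beta> - (\<beta> - \<delta>) \<in> rising F" using \<delta> l(1) F by (auto simp: \<rho>m_def field_simps)
          then show ?thesis using l(3) \<delta>(2) by simp
        qed
        ultimately show ?case by blast
      qed
    qed
  qed

  have row4: "\<forall>\<alpha> \<beta>. F = Two_Sided \<alpha> \<beta> 1 \<longrightarrow>
        (\<rho>h \<le> \<alpha> - C\<^sub>2 \<alpha> \<beta> \<longrightarrow> R \<noteq> {} \<and> R \<subseteq> {..\<alpha>} \<and> r = \<alpha>) \<and>
        (\<alpha> - C\<^sub>2 \<alpha> \<beta> < \<rho>h \<and> \<rho>h < \<rho>\<^sub>m \<alpha> \<beta> \<longrightarrow>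
           R \<inter> bounds F = {r} \<and> r \<in> {\<alpha><..<\<rho>\<^sub>m \<alpha> \<beta>} \<and>
           (mh \<noteq> 0 \<longrightarrow> second_deriv_neg L {\<alpha><..<\<rho>\<^sub>m \<alpha> \<beta>})) \<and>
        (\<rho>h = \<rho>\<^sub>m \<alpha> \<beta> \<longrightarrow> R \<inter> bounds F = {\<rho>\<^sub>m \<alpha> \<beta>} \<and> r = \<rho>\<^sub>m \<alpha> \<beta>) \<and>
        (\<rho>\<^sub>m \<alpha> \<beta> < \<rho>h \<and> \<rho>h < \<beta> + C\<^sub>2 \<alpha> \<beta> \<longrightarrow>
           R \<inter> bounds F = {r} \<and> r \<in> {\<rho>\<^sub>m \<alpha> \<beta><..<\<beta>} \<and>
           (mh \<noteq> 0 \<longrightarrow> second_deriv_pos L {\<rho>\<^sub>m \<alpha> \<beta><..<\<beta>})) \<and>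
        (\<rho>h \<ge> \<beta> + C\<^sub>2 \<alpha> \<beta> \<longrightarrow> R \<noteq> {} \<and> R \<subseteq> {\<beta>..} \<and> r = \<beta>)" (is "\<forall>\<alpha> \<beta>. ?h4 \<alpha> \<beta> \<longrightarrow> ?row4 \<alpha> \<beta>")
    and newton4: "\<forall>\<alpha> \<beta>. F = Two_Sided \<alpha> \<beta> 1 \<longrightarrow>
        (\<alpha> - C\<^sub>2 \<alpha> \<beta> < \<rho>h \<and> \<rho>h < \<rho>\<^sub>m \<alpha> \<beta> \<longrightarrow> conv \<alpha> r (mom r)) \<and>
        (\<rho>\<^sub>m \<alpha> \<beta> < \<rho>h \<and> \<rho>h < \<beta> + C\<^sub>2 \<alpha> \<beta> \<longrightarrow> conv \<beta> r (mom r))" (is ?newton4)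
  proof -
    have thr: "P.L h (left_end F) = D\<^sub>\<rho> * (\<alpha> - C\<^sub>2 \<alpha> \<beta> - h)" if "F = Two_Sided \<alpha> \<beta> 1" for \<alpha> \<beta> h
    proof -
      have "D\<^sub>\<rho> * (\<alpha> - C\<^sub>2 \<alpha> \<beta> - h) = D\<^sub>\<rho> * (\<alpha> - h) - (\<beta> - \<alpha>) / (2 * \<zeta>) * (\<Sum>j\<in>UNIV. P.w j)"
        unfolding C2_def W using \<open>D\<^sub>\<rho> > 0\<close> \<open>\<zeta> > 0\<close> by (simp add: field_simps)
      then show ?thesis using P.L_left_end[of h] that by simp
    qed
    have thr_neg: "eventually (\<lambda>x. P.L h x < 0) (at_right (left_end F))"
      if "F = Two_Sided \<alpha> \<beta> 1" "\<alpha> - C\<^sub>2 \<alpha> \<beta> < h" for \<alpha> \<beta> h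
      using P.eventually_L_neg_smooth[of h] thr[OF that(1), of h] that \<open>D\<^sub>\<rho> > 0\<close>
      by (simp add: mult_pos_neg)
    have thr_nonneg: "P.L h (left_end F) \<ge> 0"
      if "F = Two_Sided \<alpha> \<beta> 1" "h \<le> \<alpha> - C\<^sub>2 \<alpha> \<beta>" for \<alpha> \<beta> h
      using thr[OF that(1), of h] that(2) \<open>D\<^sub>\<rho> > 0\<close> by simp
    have ev_right: "eventually (\<lambda>x. P.L (\<alpha> + \<beta> - \<rho>h) x < 0) (at_right (left_end F))"
      if "F = Two_Sided \<alpha> \<beta> 1" "\<rho>h < \<beta> + C\<^sub>2 \<alpha> \<beta>" for \<alpha> \<beta>
      using thr_neg[OF that(1), of "\<alpha> + \<beta> - \<rho>h"] that(2) by simp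
    have low: "R \<noteq> {} \<and> R \<subseteq> {..\<alpha>} \<and> r = \<alpha>"
      if F: "F = Two_Sided \<alpha> \<beta> 1" and h: "\<rho>h \<le> \<alpha> - C\<^sub>2 \<alpha> \<beta>" for \<alpha> \<beta>
    proof -
      note nn = thr_nonneg[OF F h]
      have e: "exponent F = 1" using F by simp
      show ?thesis
        using P.root_left_of_left_end[OF e nn] P.root_le_left_end[OF e nn]
          P.stationary_eq_left_end[OF r e nn] F by (auto simp: R_eq)
    qed
    have high: "R \<noteq> {} \<and> R \<subseteq> {\<beta>..} \<and> r = \<beta>"
      if F: "F = Two_Sided \<alpha> \<beta> 1" and h: "\<rho>h \<ge> \<beta> + C\<^sub>2 \<alpha> \<beta>" for \<alpha> \<beta>
    proof -
      have nn: "P.L (\<alpha> + \<beta> - \<rho>h) (left_end F) \<ge> 0" using thr_nonneg[OF F] h by simp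
      have e: "exponent F = 1" using F by simp
      \<comment> \<open>Roots beyond \<beta> are mirror images of roots beyond \<alpha> for the
        input \<open>\<alpha> + \<beta> - \<rho>h\<close>.\<close>
      have refl: "x \<in> R \<longleftrightarrow> \<alpha> + \<beta> - x \<in> P.S \<and> P.L (\<alpha> + \<beta> - \<rho>h) (\<alpha> + \<beta> - x) = 0" for x
        using P.L_reflect[OF F, of x \<rho>h] P.scalar_dom_reflect[OF F, of x] F by (auto simp: R_eq)
      obtain x where "x \<in> P.S" "P.L (\<alpha> + \<beta> - \<rho>h) x = 0"
        using P.root_left_of_left_end[OF e nn] by blast
      then have "\<alpha> + \<beta> - x \<in> R" by (simp add: refl)
      moreover have "R \<subseteq> {\<beta>..}"
        using P.root_le_left_end[OF e nn] F by (force simp: refl)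
      moreover have "r = \<beta>"
        using P.stationary_eq_left_end[OF P.stationary_reflect[OF F r] e nn] F by simp
      ultimately show ?thesis by blast
    qed
    show "\<forall>\<alpha> \<beta>. ?h4 \<alpha> \<beta> \<longrightarrow> ?row4 \<alpha> \<beta>"
    proof (intro allI impI)
      fix \<alpha> \<beta> :: real assume F: "F = Two_Sided \<alpha> \<beta> 1"
      show "?row4 \<alpha> \<beta>"
        using low[OF F] high[OF F] middle[OF F] left(1,2)[OF F _ thr_neg[OF F]]
          right(1,2)[OF F _ ev_right[OF F]] snd_neg[OF F] snd_pos[OF F]
        by meson
    qed
    show ?newton4
    proof (intro allI impI)
      fix \<alpha> \<beta> :: real assume F: "F = Two_Sided \<alpha> \<beta> 1"
      have \<alpha>: "\<alpha> \<in> rising F" using \<open>admissible F\<close> by (simp add: F)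
      have "conv \<alpha> r (mom r)" if "\<alpha> - C\<^sub>2 \<alpha> \<beta> < \<rho>h" "\<rho>h < \<rho>\<^sub>m \<alpha> \<beta>"
        using left(1,3)[OF F that(2) thr_neg[OF F that(1)]] \<alpha> by simp
      moreover have "conv \<beta> r (mom r)" if "\<rho>\<^sub>m \<alpha> \<beta> < \<rho>h" "\<rho>h < \<beta> + C\<^sub>2 \<alpha> \<beta>"
        using right(1,3)[OF F that(1) ev_right[OF F that(2)]] \<alpha> by simp
      ultimately show "(\<alpha> - C\<^sub>2 \<alpha> \<beta> < \<rho>h \<and> \<rho>h < \<rho>\<^sub>m \<alpha> \<beta> \<longrightarrow> conv \<alpha> r (mom r)) \<and>
        (\<rho>\<^sub>m \<alpha> \<beta> < \<rho>h \<and> \<rho>h < \<beta> + C\<^sub>2 \<alpha> \<beta> \<longrightarrow> conv \<beta> r (mom r))"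
        by blast
    qed
  qed

  let "_ \<and> (\<forall>\<rho>s ms. _ \<rho>s ms \<longrightarrow> ?properties \<rho>s ms)" = ?thesis
  show ?thesis
  proof (intro conjI[OF ex1] allI impI)
    fix \<rho>s ms assume "sol (\<rho>s, ms)"
    then have eq: "\<rho>s = r" "ms = mom r" by (simp_all add: sol)
    show "?properties \<rho>s ms"
      unfolding eq
      by (intro conjI rb mob_nonneg[OF rb] unique vanish refl row1 row2 row3 row4
          newton1 newton2 newton3 newton4)
  qed
qed

end
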